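(* Let $n$ be a positive odd integer, and for $k\geqslant 0$ let $$c_q(k)=(-1)^k[3k+1]\frac{(q;q^2)_k^3}{(q;q)_k^3}.$$ Then $$\sum_{k=0}^{n-1}\sum_{j=0}^{k}c_q(j)c_q(k-j)\equiv q^{(n+1)/2}[n]^2\pmod{[n]\Phi_n(q)^2}.$$
   Context: Here $q$ is an indeterminate. The $q$-shifted factorial is $(x;q)_0=1$ and $(x;q)_m=(1-x)(1-xq)\cdots(1-xq^{m-1})$ for $m\geqslant1$; the $q$-integer is $[m]=1+q+\cdots+q^{m-1}=(1-q^m)/(1-q)$. $\Phi_n(q)$ denotes the $n$-th cyclotomic polynomial. For rational functions $A,B$ in $q$ and a polynomial $P$, $A\equiv B\pmod{P}$ means that $A-B=P\cdot U/V$ for polynomials $U,V$ with $V$ coprime to $P$.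
   Formalization: The case n = 1 is excluded: there the claim would read 1 ≡ q (mod (q−1)²), which is false; the theorem is stated for odd n > 1. *)

theory Defs
  imports "HOL-Computational_Algebra.Computational_Algebra"
begin

definition qpoch :: "'a::comm_ring_1 \<Rightarrow> 'a \<Rightarrow> nat \<Rightarrow> 'a" where
  "qpoch x q m = (\<Prod>i<m. 1 - x * q ^ i)"

definition qint :: "'a::comm_ring_1 \<Rightarrow> nat \<Rightarrow> 'a" where
  "qint q m = (\<Sum>i<m. q ^ i)"

lemma qint_closed_form:
  fixes q :: "'a::field"
  assumes "q \<noteq> 1"
  shows "qint q m = (1 - q ^ m) / (1 - q)"
  using assms by (simp add: qint_def sum_gp_strict)

abbreviation indet :: "rat poly" where
  "indet \<equiv> [:0, 1:]"

abbreviation qq :: "rat poly fract" where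
  "qq \<equiv> to_fract indet"

text \<open>
  The condition \<open>V \<noteq> 0\<close> follows from coprimality unless \<open>P\<close> is a unit; it is explicit because
  division by zero is total.
\<close>
definition ratfun_cong :: "rat poly fract \<Rightarrow> rat poly fract \<Rightarrow> rat poly \<Rightarrow> bool" where
  "ratfun_cong A B P \<longleftrightarrow>
     (\<exists>U V. V \<noteq> 0 \<and> coprime V P \<and> A - B = to_fract P * (to_fract U / to_fract V))"

definition cq :: "nat \<Rightarrow> rat poly fract" where
  "cq k = (- 1) ^ k * qint qq (3 * k + 1) * (qpoch qq (qq ^ 2) k ^ 3 / qpoch qq qq k ^ 3)"

definition primitive_roots_unity :: "nat \<Rightarrow> complex set" where
  "primitive_roots_unity n = {z. z ^ n = 1 \<and> (\<forall>m. 0 < m \<and> m < n \<longrightarrow> z ^ m \<noteq> 1)}"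

definition cyclotomic_complex :: "nat \<Rightarrow> complex poly" where
  "cyclotomic_complex n = (\<Prod>z\<in>primitive_roots_unity n. [:- z, 1:])"

text \<open>
  The cyclotomic polynomial has rational coefficients; the description below is shown to be
  well-defined for positive \<open>n\<close> in \<open>map_poly_cyclotomic\<close>.
\<close>
definition cyclotomic :: "nat \<Rightarrow> rat poly" where
  "cyclotomic n = (THE p. map_poly of_rat p = cyclotomic_complex n)"

lemma map_poly_of_rat_mult:
  "map_poly (of_rat :: rat \<Rightarrow> complex) (p * q) = map_poly of_rat p * map_poly of_rat q"
  by (rule poly_eqI) (simp add: coeff_map_poly coeff_mult of_rat_sum of_rat_mult)

lemma map_poly_of_rat_add:
  "map_poly (of_rat :: rat \<Rightarrow> complex) (p + q) = map_poly of_rat p + map_poly of_rat q"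
  by (rule poly_eqI) (simp add: coeff_map_poly of_rat_add)

lemma map_poly_of_rat_eq_iff:
  "map_poly (of_rat :: rat \<Rightarrow> complex) p = map_poly of_rat q \<longleftrightarrow> p = q"
  by (auto simp: poly_eq_iff coeff_map_poly)

lemma degree_map_poly_of_rat: "degree (map_poly (of_rat :: rat \<Rightarrow> complex) p) = degree p"
  by (rule degree_map_poly) auto

lemma rational_cofactor:
  fixes C :: "complex poly"
  assumes "map_poly of_rat a = map_poly of_rat b * C" and "b \<noteq> 0"
  shows "C = map_poly of_rat (a div b)"
proof -
  let ?h = "map_poly (of_rat :: rat \<Rightarrow> complex)"
  have "?h a = ?h b * ?h (a div b) + ?h (a mod b)"
    by (simp flip: map_poly_of_rat_mult map_poly_of_rat_add)
  with assms(1) have eq: "?h b * (C - ?h (a div b)) = ?h (a mod b)"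
    by (simp add: algebra_simps)
  have b0: "?h b \<noteq> 0"
    using assms(2) map_poly_of_rat_eq_iff[of b 0] by simp
  have "C - ?h (a div b) = 0"
  proof (rule ccontr)
    assume nz: "C - ?h (a div b) \<noteq> 0"
    have "degree (?h (a mod b)) = degree (?h b) + degree (C - ?h (a div b))"
      unfolding eq [symmetric] using b0 nz by (rule degree_mult_eq)
    then have "degree b \<le> degree (a mod b)"
      by (simp add: degree_map_poly_of_rat)
    moreover have "?h (a mod b) \<noteq> 0"
      using b0 nz eq by (metis mult_eq_0_iff)
    then have "a mod b \<noteq> 0" by auto
    ultimately show False
      using degree_mod_less'[OF assms(2), of a] by simp
  qed
  then show ?thesis by simp
qed

lemma finite_primitive_roots_unity:
  assumes "n > 0"
  shows "finite (primitive_roots_unity n)"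
  by (rule finite_subset[OF _ finite_roots_unity[of n]])
     (use assms in \<open>auto simp: primitive_roots_unity_def\<close>)

lemma roots_unity_partition:
  assumes n: "n > 0"
  shows "{z :: complex. z ^ n = 1} = (\<Union>d\<in>{d. d dvd n}. primitive_roots_unity d)"
proof (intro set_eqI iffI)
  fix z :: complex
  assume "z \<in> {z. z ^ n = 1}"
  then have z: "z ^ n = 1" by simp
  define d where "d = (LEAST m. 0 < m \<and> z ^ m = 1)"
  have d: "0 < d \<and> z ^ d = 1"
    unfolding d_def by (rule LeastI[of _ n]) (use n z in auto)
  have least: "z ^ m \<noteq> 1" if "0 < m" "m < d" for m
    using not_less_Least[of m "\<lambda>m. 0 < m \<and> z ^ m = 1"] that unfolding d_def by auto
  have "z ^ n = (z ^ d) ^ (n div d) * z ^ (n mod d)"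
    by (simp flip: power_mult power_add)
  with z d have "z ^ (n mod d) = 1" by simp
  with least[of "n mod d"] d have "n mod d = 0" by fastforce
  with d least show "z \<in> (\<Union>d\<in>{d. d dvd n}. primitive_roots_unity d)"
    by (auto simp: primitive_roots_unity_def mod_eq_0_iff_dvd)
qed (auto simp: primitive_roots_unity_def dvd_def power_mult)

lemma prod_roots_unity:
  assumes "n > 0"
  shows "(\<Prod>z | z ^ n = 1. [:- z, 1:]) = (monom 1 n - 1 :: complex poly)"
proof -
  let ?P = "\<Prod>z | z ^ n = 1. [:- z, 1:] :: complex poly"
  let ?Q = "monom 1 n - 1 :: complex poly"
  have fin: "finite {z :: complex. z ^ n = 1}"
    using assms finite_roots_unity[of n] by simp
  have degP: "degree ?P = n"
    using assms by (simp add: degree_prod_sum_eq card_roots_unity_eq)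
  have leadP: "lead_coeff ?P = 1"
    unfolding lead_coeff_prod by simp
  have degQ: "degree ?Q = n"
    using assms degree_diff_less[of 1 n "monom 1 n"]
    by (intro antisym degree_diff_le le_degree) (auto simp: degree_monom_eq coeff_1)
  have "?P - ?Q = 0"
  proof (rule ccontr)
    assume nz: "?P - ?Q \<noteq> 0"
    have "coeff ?P n = 1"
      using degP leadP by metis
    then have "coeff (?P - ?Q) n = 0"
      using assms by (simp add: coeff_1)
    moreover have "degree (?P - ?Q) \<le> n"
      by (rule degree_diff_le) (simp_all only: degP degQ order_refl)
    ultimately have "degree (?P - ?Q) < n"
      using nz by (metis le_neq_implies_less leading_coeff_0_iff)
    moreover have "{z. z ^ n = 1} \<subseteq> {z. poly (?P - ?Q) z = 0}"
      using fin by (auto simp: poly_prod poly_monom)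
    then have "n \<le> card {z. poly (?P - ?Q) z = 0}"
      using card_mono[OF poly_roots_finite[OF nz]] card_roots_unity_eq[OF assms] by metis
    then have "n \<le> degree (?P - ?Q)"
      using card_poly_roots_bound[OF nz] by linarith
    ultimately show False by simp
  qed
  then show ?thesis by simp
qed

lemma prod_cyclotomic_complex:
  assumes "n > 0"
  shows "(\<Prod>d | d dvd n. cyclotomic_complex d) = monom 1 n - 1"
proof -
  have disj: "primitive_roots_unity d \<inter> primitive_roots_unity e = {}"
    if "d dvd n" "e dvd n" "d \<noteq> e" for d e
  proof -
    have "0 < d" "0 < e" using that assms dvd_pos_nat by auto
    with that show ?thesis
      by (cases "d < e") (auto simp: primitive_roots_unity_def)
  qed
  have "(\<Prod>d | d dvd n. cyclotomic_complex d) =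
        (\<Prod>z\<in>(\<Union>d\<in>{d. d dvd n}. primitive_roots_unity d). [:- z, 1:])"
    unfolding cyclotomic_complex_def
    by (rule prod.UNION_disjoint [symmetric])
       (use assms disj finite_primitive_roots_unity dvd_pos_nat in auto)
  then show ?thesis
    using prod_roots_unity[OF assms] roots_unity_partition[OF assms] by simp
qed

lemma cyclotomic_complex_rational:
  "n > 0 \<Longrightarrow> \<exists>p. map_poly of_rat p = cyclotomic_complex n"
proof (induction n rule: less_induct)
  case (less n)
  let ?h = "map_poly (of_rat :: rat \<Rightarrow> complex)"
  let ?D = "{d. d dvd n \<and> d < n}"
  have "\<forall>d\<in>?D. \<exists>p. ?h p = cyclotomic_complex d"
    using less dvd_pos_nat by blast
  then obtain f where f: "\<And>d. d \<in> ?D \<Longrightarrow> ?h (f d) = cyclotomic_complex d"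
    by metis
  have h_prod: "?h (\<Prod>d\<in>A. f d) = (\<Prod>d\<in>A. ?h (f d))" for A
    by (induction A rule: infinite_finite_induct) (simp_all add: map_poly_of_rat_mult)
  have hb: "?h (\<Prod>d\<in>?D. f d) = (\<Prod>d\<in>?D. cyclotomic_complex d)"
    unfolding h_prod by (rule prod.cong) (use f in auto)
  have divs: "{d. d dvd n} = insert n ?D"
    using less.prems by (auto dest: dvd_imp_le)
  have "(\<Prod>d\<in>?D. cyclotomic_complex d) * cyclotomic_complex n = monom 1 n - 1"
    using prod_cyclotomic_complex[OF less.prems] unfolding divs
    by (subst (asm) prod.insert) (auto simp: mult.commute)
  also have "\<dots> = ?h (monom 1 n - 1)"
    by (rule poly_eqI) (simp add: coeff_map_poly coeff_1)
  finally have "?h (monom 1 n - 1) = ?h (\<Prod>d\<in>?D. f d) * cyclotomic_complex n"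
    using hb by simp
  moreover have "(\<Prod>d\<in>?D. f d) \<noteq> 0"
  proof
    assume "(\<Prod>d\<in>?D. f d) = 0"
    with hb have "(\<Prod>d\<in>?D. cyclotomic_complex d) = 0" by simp
    then obtain d where "d \<in> ?D" "cyclotomic_complex d = 0"
      by (auto simp: prod_zero_iff)
    then show False
      using finite_primitive_roots_unity[of d] dvd_pos_nat[of n d] less.prems
      by (auto simp: cyclotomic_complex_def)
  qed
  ultimately show ?case
    using rational_cofactor by metis
qed

lemma map_poly_cyclotomic:
  assumes "n > 0"
  shows "map_poly of_rat (cyclotomic n) = cyclotomic_complex n"
proof -
  obtain p where "map_poly of_rat p = cyclotomic_complex n"
    using cyclotomic_complex_rational[OF assms] by blast
  then show ?thesis
    unfolding cyclotomic_def
    by (rule theI) (use \<open>map_poly of_rat p = cyclotomic_complex n\<close> map_poly_of_rat_eq_iff in metis)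
qed

text \<open>
  For \<open>n = 1\<close> the congruence reads \<open>1 \<equiv> q (mod (q - 1)^2)\<close>, which is false
  (see \<open>congruence_fails_at_1\<close>).
\<close>
lemma cyclotomic_1: "cyclotomic 1 = [:- 1, 1:]"
proof -
  have "primitive_roots_unity 1 = {1}"
    by (auto simp: primitive_roots_unity_def)
  then have "cyclotomic_complex 1 = map_poly of_rat [:- 1, 1:]"
    by (simp add: cyclotomic_complex_def map_poly_pCons)
  then show ?thesis
    using map_poly_cyclotomic[of 1] map_poly_of_rat_eq_iff by simp
qed

lemma congruence_fails_at_1:
  "\<not> ratfun_cong (\<Sum>k = 0..1 - 1. \<Sum>j = 0..k. cq j * cq (k - j))
      (qq ^ ((1 + 1) div 2) * qint qq 1 ^ 2) (qint indet 1 * cyclotomic 1 ^ 2)"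
proof
  assume "ratfun_cong (\<Sum>k = 0..1 - 1. \<Sum>j = 0..k. cq j * cq (k - j))
      (qq ^ ((1 + 1) div 2) * qint qq 1 ^ 2) (qint indet 1 * cyclotomic 1 ^ 2)"
  then have "ratfun_cong 1 qq ([:- 1, 1:] ^ 2)"
    by (simp add: cq_def qint_def qpoch_def cyclotomic_1 [simplified])
  then obtain U V where V: "V \<noteq> 0" "coprime V ([:- 1, 1:] ^ 2)"
    and eq: "1 - qq = to_fract ([:- 1, 1:] ^ 2) * (to_fract U / to_fract V)"
    by (auto simp: ratfun_cong_def)
  have "(1 - qq) * to_fract V = to_fract ([:- 1, 1:] ^ 2) * to_fract U"
    unfolding eq using V(1) by simp
  then have "to_fract ((1 - indet) * V) = to_fract ([:- 1, 1:] ^ 2 * U)"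
    by (simp only: to_fract_mult to_fract_diff to_fract_1)
  then have "(1 - indet) * V = [:- 1, 1:] ^ 2 * U"
    by (simp only: to_fract_eq_iff)
  moreover have "1 - indet = - [:- 1, 1:]" by (simp add: one_pCons)
  ultimately have "[:- 1, 1:] * (- V) = [:- 1, 1:] * ([:- 1, 1:] * U)"
    by (simp only: power2_eq_square mult.assoc minus_mult_left [symmetric] minus_mult_right [symmetric])
  then have "- V = [:- 1, 1:] * U"
    by (subst (asm) mult_left_cancel) auto
  then have "[:- 1, 1:] dvd V"
    by (metis dvd_minus_iff dvd_triv_left)
  moreover have "([:- 1, 1:] :: rat poly) dvd [:- 1, 1:] ^ 2" by simp
  ultimately have "is_unit ([:- 1, 1:] :: rat poly)"
    using V(2) coprime_common_divisor by blast
  then show False by (simp add: is_unit_pCons_iff)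
qed

end

theory Submission
  imports Defs "HOL-Computational_Algebra.Field_as_Ring"
begin

text \<open>
  Write \<open>n = 2 M + 1\<close> and let \<open>C(N)\<close> be the sum of the first \<open>N\<close> terms of \<open>c\<^sub>q\<close>, so that the double sum is
  \<open>\<Sum>j<n. c\<^sub>q(j) C(n - j)\<close>.

  Modulo \<open>\<Phi>\<^sub>n\<^sup>3\<close> the terms \<open>c\<^sub>q(k)\<close> with \<open>M < k < n\<close> vanish, so the double sum is congruent to
  \<open>S\<^sup>2\<close> with \<open>S = \<Sum>k\<le>M. c\<^sub>q(k)\<close>. Two factors of the numerator \<open>(q;q\<^sup>2)\<^sub>k\<^sup>3\<close> and of the denominator
  \<open>(q;q)\<^sub>k\<^sup>3\<close> may be replaced by \<open>(uq, q/u; q\<^sup>2)\<^sub>k\<close> and \<open>(uq, q/u; q)\<^sub>k\<close> with \<open>u = q\<^sup>n\<close>; since the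
  product is symmetric in \<open>u\<close> and \<open>1/u\<close>, this changes it only by a multiple of \<open>(1 - u)\<^sup>2\<close>. The
  deformed sum is evaluated in closed form as \<open>T = (-1)\<^sup>M q^(M\<^sup>2) [n]\<close> by a WZ argument in the
  direction \<open>u \<mapsto> u q\<^sup>2\<close>. Hence \<open>S \<equiv> T\<close> modulo \<open>\<Phi>\<^sub>n\<^sup>2\<close>, and as \<open>S + T\<close> is divisible by \<open>\<Phi>\<^sub>n\<close>,
  even \<open>S\<^sup>2 \<equiv> T\<^sup>2\<close> modulo \<open>\<Phi>\<^sub>n\<^sup>3\<close>.

  For \<open>d\<close> dividing \<open>n\<close> there is a Lucas-type congruence \<open>c\<^sub>q(l d + r) \<equiv> e\<^sub>l c\<^sub>q(r)\<close> modulo \<open>\<Phi>\<^sub>d\<close>.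
  Together with the vanishing of \<open>\<Sum>r<d. c\<^sub>q(r)\<close> it shows that, for every \<open>j\<close>, either \<open>c\<^sub>q(j)\<close> or
  \<open>C(n - j)\<close> vanishes modulo \<open>\<Phi>\<^sub>d\<close>. The congruences for the different \<open>d\<close> combine by coprimality.
\<close>

section \<open>The WZ evaluation\<close>

text \<open>
  With \<open>y = q\<^bsup>2i+1\<^esup>\<close> and \<open>w = q\<^bsup>i+1\<^esup>\<close>, the quotient \<open>(1 - y/u) / (1 - w/u)\<close> is written as
  \<open>(y - u) / (w - u)\<close>.
\<close>
definition wz_ratio :: "'a::field \<Rightarrow> 'a \<Rightarrow> nat \<Rightarrow> 'a" where
  "wz_ratio q u i =
     ((1 - u * q ^ (2 * i + 1)) * (q ^ (2 * i + 1) - u) * (1 - q ^ (2 * i + 1))) /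
     ((1 - u * q ^ (i + 1)) * (q ^ (i + 1) - u) * (1 - q ^ (i + 1)))"

text \<open>The deformation of \<open>cq k\<close>, which is recovered at \<open>u = 1\<close>. The
  parameter \<open>u\<close> is kept free because the WZ recurrence runs in
  \<open>u\<close>.\<close>

definition wz_term :: "'a::field \<Rightarrow> 'a \<Rightarrow> nat \<Rightarrow> 'a" where
  "wz_term q u k = (- 1) ^ k * qint q (3 * k + 1) * (\<Prod>i<k. wz_ratio q u i)"

text \<open>Up to powers of \<open>q\<close>, replacing \<open>u\<close> by \<open>u * q ^ 2\<close>
  moves the numerator factors that contain \<open>u\<close> by one index and the denominator factors
  that contain \<open>u\<close> by two, so the quotient of the two products telescopes. The identity
  is stated cross-multiplied.\<close>

lemma wz_prod_shift:
  fixes q u :: "'a::field"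
  assumes "u \<noteq> 1"
    and "\<And>i. i \<le> k \<Longrightarrow> u * q \<noteq> q ^ (2 * i)"
    and "\<And>i. i \<le> k \<Longrightarrow> u * q ^ (i + 1) \<noteq> 1 \<and> u * q ^ (i + 2) \<noteq> 1"
    and "\<And>i. i < k \<Longrightarrow> q ^ (i + 1) \<noteq> u \<and> q ^ (i + 1) \<noteq> 1 \<and> q ^ (i + 1) \<noteq> u * q^2"
    and "q \<noteq> 0"
  shows "(\<Prod>i<k. wz_ratio q (u * q ^ 2) i) *
       ((u * q - q ^ (2 * k)) * (1 - u * q ^ (k + 1)) * (1 - u * q ^ (k + 2)) * (u - 1)) =
     (\<Prod>i<k. wz_ratio q u i) *
       ((1 - u * q ^ (2 * k + 1)) * (1 - u * q ^ 2) * (u * q - q ^ k) * (u - q ^ k))"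
  using assms
proof (induction k)
  case 0
  then show ?case by (simp add: algebra_simps power2_eq_square)
next
  case (Suc k)
  define x P1 P2 where "x = q ^ k" and "P1 = (\<Prod>i<k. wz_ratio q (u * q ^ 2) i)"
    and "P2 = (\<Prod>i<k. wz_ratio q u i)"
  have pw: "q ^ k = x" "q ^ (k + 1) = q * x" "q ^ (k + 2) = q^2 * x" "q ^ (2 * k) = x^2" "q ^ (2 * k + 1) = q * x^2"
    "q ^ Suc k = q * x" "q ^ (Suc k + 1) = q^2 * x" "q ^ (Suc k + 2) = q^3 * x"
    "q ^ (2 * Suc k) = q^2 * x^2" "q ^ (2 * Suc k + 1) = q^3 * x^2"
    by (simp_all add: x_def power_add power2_eq_square power3_eq_cube mult_2)
  have "P1 * ((u * q - q ^ (2 * k)) * (1 - u * q ^ (k + 1)) * (1 - u * q ^ (k + 2)) * (u - 1)) =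
     P2 * ((1 - u * q ^ (2 * k + 1)) * (1 - u * q ^ 2) * (u * q - q ^ k) * (u - q ^ k))"
    unfolding P1_def P2_def using Suc.prems by (intro Suc.IH) auto
  note IH = this[unfolded pw]
  have nz: "u * q - x^2 \<noteq> 0" "1 - u * (q * x) \<noteq> 0" "1 - u * (q^2 * x) \<noteq> 0" "u - 1 \<noteq> 0"
      "q * x - u \<noteq> 0" "1 - q * x \<noteq> 0" "q * x - u * q^2 \<noteq> 0" "1 - u * (q^3 * x) \<noteq> 0"
    using Suc.prems(2)[of k] Suc.prems(3)[of k] Suc.prems(3)[of "Suc k"] Suc.prems(4)[of k] Suc.prems(1,5)
    unfolding pw by auto
  then have nz2: "u * q - x \<noteq> 0"
    using Suc.prems(5) by (auto simp: power2_eq_square)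
  have r1: "wz_ratio q (u * q^2) k = ((1 - u * (q ^ 3 * x^2)) * (q * x^2 - u * q^2) * (1 - q * x^2)) /
     ((1 - u * (q^3 * x)) * (q * x - u * q^2) * (1 - q * x))"
    unfolding wz_ratio_def pw by (simp add: power2_eq_square power3_eq_cube mult_ac)
  have r2: "wz_ratio q u k = ((1 - u * (q * x^2)) * (q * x^2 - u) * (1 - q * x^2)) /
     ((1 - u * (q * x)) * (q * x - u) * (1 - q * x))"
    unfolding wz_ratio_def pw by (simp add: mult_ac)
  \<comment> \<open>The letters stand for the factors as they occur below, so the cancellation is
    checked on independent unknowns and not on polynomials in \<open>u\<close> and
    \<open>x\<close>.\<close>
  have cancel: "P1 * ((W * (- q * A) * K) / (L * (- q * G) * Y)) * ((- q * N) * C * L * D) =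
      P2 * ((E * N * K) / (B * J * Y)) * (W * F * (q * H) * (- J))"
    if "P1 * (A * B * C * D) = P2 * (E * F * G * H)"
      "B \<noteq> 0" "L \<noteq> 0" "G \<noteq> 0" "Y \<noteq> 0" "J \<noteq> 0"
    for A B C D E F G H J K L N W Y
  proof -
    have "P1 * A * C * D / G = P2 * E * F * H / B"
      using that by (simp add: divide_simps mult_ac)
    moreover have "P1 * ((W * (- q * A) * K) / (L * (- q * G) * Y)) * ((- q * N) * C * L * D) =
      (P1 * A * C * D / G) * (- q * N * W * K / Y)"
      using that(2-) Suc.prems(5) by simp
    moreover have "P2 * ((E * N * K) / (B * J * Y)) * (W * F * (q * H) * (- J)) =
      (P2 * E * F * H / B) * (- q * N * W * K / Y)"
      using that(2-) by simp
    ultimately show ?thesis by simp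
  qed
  have id: "q * x - u * q^2 = - q * (u * q - x)" "q * x^2 - u * q^2 = - q * (u * q - x^2)"
    "u * q - q^2 * x^2 = - q * (q * x^2 - u)" "u * q - q * x = q * (u - x)" "u - q * x = - (q * x - u)"
    by (simp_all add: algebra_simps power2_eq_square)
  have "P1 * wz_ratio q (u * q ^ 2) k *
       ((u * q - q^2 * x^2) * (1 - u * (q^2 * x)) * (1 - u * (q^3 * x)) * (u - 1)) =
     P2 * wz_ratio q u k *
       ((1 - u * (q^3 * x^2)) * (1 - u * q ^ 2) * (u * q - q * x) * (u - q * x))"
    unfolding r1 r2 id by (rule cancel[OF IH]) (use nz nz2 in auto)
  then show ?case
    by (simp only: prod.lessThan_Suc P1_def P2_def pw)
qed


text \<open>The induction step of \<open>wz_telescope\<close> after removal of a common factor, with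
  \<open>x = q ^ k\<close> and \<open>z = q ^ (k + 1)\<close>: the old closed form plus the two new
  terms is the new closed form. Clearing denominators leaves a polynomial identity.\<close>

lemma wz_core:
  fixes q u x z :: "'a::field"
  assumes "z = q * x" "q \<noteq> 0" "1 - u * q * z \<noteq> 0" "z - u \<noteq> 0" "1 - z \<noteq> 0" "1 - u * q^2 * z \<noteq> 0"
  shows "(1 - u^2 * q^2) * x / (1 - u * q * z) +
      (1 - q * z^3) * ((1 - u * q * z^2) * (u * q - z) / (q * (1 - z) * (1 - u * q * z) * (1 - u * q^2 * z)))
      - u * (1 - q * z^3) * ((q * x^2 - u) / ((z - u) * (1 - z))) =
     - ((q * x^2 - u) / ((z - u) * (1 - z))) * ((1 - u^2 * q^2) * (1 - u * q * z^2) * (1 - q * z^2) * z /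
        ((1 - u * q * z) * (1 - u * q^2 * z)))"
proof -
  define A B C D where "A = 1 - u * q * z" and "B = z - u" and "C = 1 - z" and "D = 1 - u * q^2 * z"
  define E F G where "E = (1 - u^2 * q^2) * x" and "F = (1 - q * z^3) * ((1 - u * q * z^2) * (u * q - z))"
    and "G = u * (1 - q * z^3) * (q * x^2 - u)"
  define H where "H = (q * x^2 - u) * ((1 - u^2 * q^2) * (1 - u * q * z^2) * (1 - q * z^2) * z)"
  have *: "E * q * B * C * D + F * B - G * q * A * D + H * q = 0"
    unfolding A_def B_def C_def D_def E_def F_def G_def H_def assms(1) by algebra
  have nz: "A \<noteq> 0" "B \<noteq> 0" "C \<noteq> 0" "D \<noteq> 0" using assms by (simp_all add: A_def B_def C_def D_def)
  have "E / A + F / (q * C * A * D) - G / (B * C) + H / (B * C * (A * D)) =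
    (E * q * B * C * D + F * B - G * q * A * D + H * q) / (q * A * B * C * D)"
    using nz assms(2) by (simp add: add_divide_distrib diff_divide_distrib mult_ac)
  then have "E / A + F / (q * C * A * D) - G / (B * C) = - (H / (B * C * (A * D)))"
    unfolding * by (simp add: add_eq_0_iff)
  then show ?thesis
    by (simp add: A_def B_def C_def D_def E_def F_def G_def H_def)
qed


text \<open>
  The right-hand side is the WZ certificate, expressed through the last term of the sum so that it
  stays regular for \<open>u = q\<^bsup>2k+1\<^esup>\<close>.
\<close>
lemma wz_telescope:
  fixes q u :: "'a::field"
  assumes "q \<noteq> 0" "q \<noteq> 1" "u \<noteq> 1"
    and "\<And>i. i \<le> k \<Longrightarrow> u * q \<noteq> q ^ (2 * i)"
    and "\<And>i. i \<le> k \<Longrightarrow> u * q ^ (i + 1) \<noteq> 1 \<and> u * q ^ (i + 2) \<noteq> 1"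
    and "\<And>i. i < k \<Longrightarrow> q ^ (i + 1) \<noteq> u \<and> q ^ (i + 1) \<noteq> 1 \<and> q ^ (i + 1) \<noteq> u * q^2"
  shows "(\<Sum>j\<le>k. wz_term q (u * q^2) j + u * (1 - u * q^2) / (1 - u) * wz_term q u j) =
    (- 1) ^ k * (\<Prod>i<k. wz_ratio q u i) / (1 - q) * ((1 - u * q^2) / (1 - u)) *
    ((1 - u^2 * q^2) * (1 - u * q ^ (2 * k + 1)) * (1 - q ^ (2 * k + 1)) * q ^ k /
      ((1 - u * q ^ (k + 1)) * (1 - u * q ^ (k + 2))))"
  using assms
proof (induction k)
  case 0
  define D where "D = 1 - u * q^2"
  have nz: "1 - u * q \<noteq> 0" "1 - q \<noteq> 0" "1 - u \<noteq> 0" "D \<noteq> 0"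
    using 0 by (auto simp: D_def numeral_2_eq_2)
  have "1 + u * D / (1 - u) = (1 - u^2 * q^2) / (1 - u)"
    unfolding D_def using nz by (simp add: field_simps power2_eq_square)
  moreover have "\<dots> = 1 / (1 - q) * (D / (1 - u)) * ((1 - u^2 * q^2) * (1 - u * q) * (1 - q) / ((1 - u * q) * D))"
    using nz by simp
  ultimately show ?case
    by (simp add: wz_term_def qint_def D_def numeral_2_eq_2)
next
  case (Suc k)
  define x z T where "x = q ^ k" and "z = q * x" and "T = (\<Prod>i<k. wz_ratio q u i)"
  define T1 where "T1 = (\<Prod>i<Suc k. wz_ratio q u i)"
  define T2 where "T2 = (\<Prod>i<Suc k. wz_ratio q (u * q^2) i)"
  define e where "e = q * x^2 - u"
  have "q ^ (3 * Suc k + 1) = q * z^3"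
    unfolding mult.commute[of 3 "Suc k"] power_add power_mult z_def x_def by (simp add: mult_ac)
  then have pw: "q ^ k = x" "q ^ (k + 1) = z" "q ^ (k + 2) = q * z" "q ^ (2 * k) = x^2" "q ^ (2 * k + 1) = q * x^2"
    "q ^ Suc k = z" "q ^ (Suc k + 1) = q * z" "q ^ (Suc k + 2) = q^2 * z"
    "q ^ (2 * Suc k) = z^2" "q ^ (2 * Suc k + 1) = q * z^2" "q ^ (3 * Suc k + 1) = q * z^3"
    by (simp_all add: x_def z_def power_add power2_eq_square power3_eq_cube mult_2)
  have nz: "1 - u * q * z \<noteq> 0" "1 - u * q^2 * z \<noteq> 0" "1 - u \<noteq> 0" "u - 1 \<noteq> 0" "u * q - z^2 \<noteq> 0"
      "z - u \<noteq> 0" "1 - z \<noteq> 0" "1 - u * z \<noteq> 0" "1 - q \<noteq> 0"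
    using Suc.prems(4)[of "Suc k"] Suc.prems(5)[of k] Suc.prems(5)[of "Suc k"] Suc.prems(6)[of k] Suc.prems(1-3)
    unfolding pw by (auto simp: mult.assoc)
  \<comment> \<open>The hypothesis for the index \<open>Suc k\<close> thus says that
    \<open>e\<close> is nonzero, so that \<open>T2\<close> can be solved for.\<close>
  have e: "u * q - z^2 = - q * e" by (simp add: e_def z_def algebra_simps power2_eq_square)
  have ez: "e \<noteq> 0" using nz e by auto
  \<comment> \<open>The factor shared by the old closed form, both new terms and the new closed
    form; what remains without it is \<open>wz_core\<close>.\<close>
  define B where "B = (- 1) ^ k * T / (1 - q) * ((1 - u * q^2) / (1 - u)) * ((1 - u * (q * x^2)) * (1 - q * x^2) / (1 - u * z))"
  have T1: "T1 = T * (((1 - u * (q * x^2)) * e * (1 - q * x^2)) / ((1 - u * z) * (z - u) * (1 - z)))"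
    unfolding T1_def T_def prod.lessThan_Suc wz_ratio_def pw e_def by (simp add: mult_ac)
  have "T2 * ((u * q - z^2) * (1 - u * (q * z)) * (1 - u * (q^2 * z)) * (u - 1)) =
     T1 * ((1 - u * (q * z^2)) * (1 - u * q ^ 2) * (u * q - z) * (u - z))"
    using wz_prod_shift[of u "Suc k" q, unfolded pw] Suc.prems unfolding T1_def T2_def by blast
  then have T2: "T2 = T1 * ((1 - u * (q * z^2)) * (1 - u * q ^ 2) * (u * q - z) * (u - z)) /
      ((- q * e) * (1 - u * (q * z)) * (1 - u * (q^2 * z)) * (u - 1))"
    using nz ez Suc.prems(1) unfolding e by (subst nonzero_eq_divide_eq) (simp_all add: mult.assoc)
  have h0: "(\<Sum>j\<le>k. wz_term q (u * q^2) j + u * (1 - u * q^2) / (1 - u) * wz_term q u j) =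
     B * ((1 - u^2 * q^2) * x / (1 - u * q * z))"
    using Suc.IH Suc.prems unfolding B_def T_def pw by (simp add: mult_ac)
  have b1: "- ((- 1) ^ k * T1 / (1 - q) * ((1 - u * q^2) / (1 - u))) = - B * (e / ((z - u) * (1 - z)))"
    unfolding T1 B_def by (simp add: mult_ac)
  have b2: "- ((- 1) ^ k * T2 / (1 - q)) = B * ((1 - u * q * z^2) * (u * q - z) / (q * (1 - z) * (1 - u * q * z) * (1 - u * q^2 * z)))"
  proof -
    have uz: "(u - z) / (u - 1) = (z - u) / (1 - u)"
      using nz by (subst frac_eq_eq) (simp_all add: algebra_simps)
    have "- ((- 1) ^ k * T2 / (1 - q)) = (- 1) ^ k * T1 / (1 - q) * ((1 - u * q^2) * ((u - z) / (u - 1))) *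
       ((1 - u * (q * z^2)) * (u * q - z) / (q * e * (1 - u * (q * z)) * (1 - u * (q^2 * z))))"
      unfolding T2 by (simp add: mult_ac)
    also have "\<dots> = - (- ((- 1) ^ k * T1 / (1 - q) * ((1 - u * q^2) / (1 - u)))) * ((z - u) *
       ((1 - u * (q * z^2)) * (u * q - z) / (q * e * (1 - u * (q * z)) * (1 - u * (q^2 * z)))))"
      unfolding uz by simp
    also have "\<dots> = B * ((1 - u * q * z^2) * (u * q - z) / (q * (1 - z) * (1 - u * q * z) * (1 - u * q^2 * z)))"
      unfolding b1 using ez nz by (simp add: mult_ac)
    finally show ?thesis .
  qed
  have qi: "qint q (3 * Suc k + 1) = (1 - q * z^3) / (1 - q)"
    using qint_closed_form[OF Suc.prems(2), of "3 * Suc k + 1"] unfolding pw .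
  have t2: "wz_term q (u * q^2) (Suc k) =
    B * ((1 - q * z^3) * ((1 - u * q * z^2) * (u * q - z) / (q * (1 - z) * (1 - u * q * z) * (1 - u * q^2 * z))))"
  proof -
    have "wz_term q (u * q^2) (Suc k) = - ((- 1) ^ k * T2 / (1 - q)) * (1 - q * z^3)"
      unfolding wz_term_def qi T2_def[symmetric] by (simp add: mult_ac)
    then show ?thesis unfolding b2 by simp
  qed
  have t1: "u * (1 - u * q^2) / (1 - u) * wz_term q u (Suc k) = - (B * (u * (1 - q * z^3) * (e / ((z - u) * (1 - z)))))"
  proof -
    have "u * (1 - u * q^2) / (1 - u) * wz_term q u (Suc k) =
        - ((- 1) ^ k * T1 / (1 - q) * ((1 - u * q^2) / (1 - u))) * (u * (1 - q * z^3))"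
      unfolding wz_term_def qi T1_def[symmetric] by (simp add: mult_ac)
    then show ?thesis unfolding b1 by simp
  qed
  have "(\<Sum>j\<le>Suc k. wz_term q (u * q^2) j + u * (1 - u * q^2) / (1 - u) * wz_term q u j) =
     B * ((1 - u^2 * q^2) * x / (1 - u * q * z) +
      (1 - q * z^3) * ((1 - u * q * z^2) * (u * q - z) / (q * (1 - z) * (1 - u * q * z) * (1 - u * q^2 * z)))
      - u * (1 - q * z^3) * (e / ((z - u) * (1 - z))))"
    unfolding sum.atMost_Suc h0 t1 t2 by (simp only: distrib_left right_diff_distrib diff_conv_add_uminus minus_mult_right add.assoc)
  also have "\<dots> = - B * (e / ((z - u) * (1 - z))) * ((1 - u^2 * q^2) * (1 - u * q * z^2) * (1 - q * z^2) * z /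
        ((1 - u * q * z) * (1 - u * q^2 * z)))"
    unfolding e_def by (subst wz_core) (use nz Suc.prems(1) z_def in auto)
  also have "\<dots> = (- 1) ^ Suc k * T1 / (1 - q) * ((1 - u * q^2) / (1 - u)) * ((1 - u^2 * q^2) * (1 - u * q * z^2) * (1 - q * z^2) * z /
        ((1 - u * q * z) * (1 - u * q^2 * z)))"
    unfolding b1[symmetric] by simp
  finally show ?case unfolding T1_def[symmetric] pw by (simp only: mult.assoc)
qed


lemma power_eq_iff_of_not_root_of_unity:
  fixes q :: "'a::field"
  assumes "q \<noteq> 0" and "\<And>m. m > 0 \<Longrightarrow> q ^ m \<noteq> 1"
  shows "q ^ a = q ^ b \<longleftrightarrow> a = b"
proof -
  have "a = b" if "q ^ a = q ^ b" "a \<le> b" for a b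
  proof -
    have "q ^ a * q ^ (b - a) = q ^ b"
      using that(2) by (simp flip: power_add)
    then have "q ^ a * q ^ (b - a) = q ^ a * 1"
      using that(1) by simp
    then have "q ^ (b - a) = 1" using assms(1) by simp
    then show ?thesis using assms(2)[of "b - a"] that by fastforce
  qed
  then show ?thesis by (metis linear)
qed

text \<open>Going from \<open>M\<close> to \<open>Suc M\<close> replaces
  \<open>u = q ^ (2 * M + 1)\<close> by \<open>u * q ^ 2\<close>. In \<open>wz_telescope\<close>
  with \<open>k = M\<close> the certificate is cancelled by the one surplus term of the new sum,
  which leaves a first-order recurrence with factor \<open>- u * (1 - u * q ^ 2) / (1 - u)\<close>.
  For this \<open>u\<close> the terms beyond \<open>M\<close> vanish, since \<open>wz_ratio\<close>
  has a zero numerator at \<open>i = M\<close>.\<close>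

lemma wz_sum:
  fixes q :: "'a::field"
  assumes q0: "q \<noteq> 0" and q1: "\<And>m. m > 0 \<Longrightarrow> q ^ m \<noteq> 1"
  shows "(\<Sum>k\<le>M. wz_term q (q ^ (2 * M + 1)) k) = (- 1) ^ M * q ^ M\<^sup>2 * qint q (2 * M + 1)"
proof (induction M)
  case 0
  then show ?case by (simp add: wz_term_def)
next
  case (Suc M)
  have inj: "q ^ a = q ^ b \<longleftrightarrow> a = b" for a b
    using power_eq_iff_of_not_root_of_unity[OF q0] q1 by blast
  define u x T where "u = q ^ (2 * M + 1)" and "x = q ^ M" and "T = (\<Prod>i<M. wz_ratio q u i)"
  define T2 where "T2 = (\<Prod>i<M. wz_ratio q (u * q^2) i)"
  have qn1: "q \<noteq> 1" using q1[of 1] by simp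
  have "q ^ (3 * Suc M + 1) = q ^ 4 * (q ^ M) ^ 3"
    by (simp flip: power_mult power_add) (simp add: mult.commute)
  moreover have "q ^ (2 * M) = (q ^ M)\<^sup>2"
    by (rule power_even_eq)
  ultimately have pw: "q ^ M = x" "q ^ (M + 1) = q * x" "q ^ (M + 2) = q^2 * x" "q ^ (2 * M + 1) = u"
      "q ^ (2 * Suc M + 1) = u * q^2" "q ^ (2 * M) = x^2" "q ^ (3 * Suc M + 1) = q^4 * x^3"
    by (simp_all add: x_def u_def power_add power2_eq_square mult_2 mult_ac)
  have ux: "u = q * x^2" by (simp add: u_def x_def power_add power2_eq_square mult_2)
  have un1: "u \<noteq> 1" unfolding u_def by (rule q1) simp
  have "u * q = q ^ (2 * M + 2)" by (simp add: u_def)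
  then have c1: "u * q \<noteq> q ^ (2 * i)" if "i \<le> M" for i
    using inj[of "2 * M + 2" "2 * i"] that by (simp only:)
  have c2: "u * q ^ (i + 1) \<noteq> 1 \<and> u * q ^ (i + 2) \<noteq> 1" for i
    unfolding u_def power_add[symmetric] by (intro conjI q1) simp_all
  have c3: "q ^ (i + 1) \<noteq> u \<and> q ^ (i + 1) \<noteq> 1 \<and> q ^ (i + 1) \<noteq> u * q^2" if "i < M" for i
    unfolding u_def power_add[symmetric] inj using that q1[of "i + 1"] by auto
  have nz: "1 - q \<noteq> 0" "1 - q^2 \<noteq> 0" "1 - q * x \<noteq> 0" "1 - q^2 * x \<noteq> 0" "1 - u \<noteq> 0" "x \<noteq> 0"
     "1 - u * (q * x) \<noteq> 0" "1 - u * (q^2 * x) \<noteq> 0" "1 - q^4 * x^3 \<noteq> 0"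
    using q1[of 1] q1[of 2] q1[of "M + 1"] q1[of "M + 2"] q1[of "3 * Suc M + 1"] un1 c2[of M] q0
    unfolding pw by (auto simp: x_def)
  \<comment> \<open>The certificate at \<open>k = M\<close> with \<open>q ^ (2 * M + 1) = u\<close>
    inserted; \<open>last\<close> below identifies the surplus term as \<open>- Q\<close>.\<close>
  define Q where "Q = (- 1) ^ M * T / (1 - q) * (1 - u * q^2) * (1 - u^2 * q^2) * (1 - u^2) * x /
      ((1 - u * (q * x)) * (1 - u * (q^2 * x)))"
  have "(\<Sum>j\<le>M. wz_term q (u * q^2) j + u * (1 - u * q^2) / (1 - u) * wz_term q u j) =
    (- 1) ^ M * T / (1 - q) * ((1 - u * q^2) / (1 - u)) *
    ((1 - u^2 * q^2) * (1 - u * u) * (1 - u) * x / ((1 - u * (q * x)) * (1 - u * (q^2 * x))))"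
    using wz_telescope[OF q0 qn1 un1 c1 c2 c3, of M] unfolding pw T_def by simp
  also have "\<dots> = Q"
    using nz by (simp add: Q_def power2_eq_square)
  finally have tele: "(\<Sum>j\<le>M. wz_term q (u * q^2) j) + u * (1 - u * q^2) / (1 - u) * (\<Sum>j\<le>M. wz_term q u j) = Q"
    by (simp add: sum.distrib sum_distrib_left)
  have "T2 * ((u * q - x^2) * (1 - u * (q * x)) * (1 - u * (q^2 * x)) * (u - 1)) =
     T * ((1 - u * u) * (1 - u * q ^ 2) * (u * q - x) * (u - x))"
    using wz_prod_shift[OF un1 c1 c2 c3 q0, of M] unfolding pw T_def T2_def by simp
  moreover have "u * q - x^2 = - (x^2) * (1 - q^2)" "u * q - x = - x * (1 - q^2 * x)" "u - x = - x * (1 - q * x)" "u - 1 = - (1 - u)"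
    by (simp_all add: ux algebra_simps power2_eq_square)
  ultimately have "T2 * (- (x^2) * (1 - q^2) * (1 - u * (q * x)) * (1 - u * (q^2 * x)) * - (1 - u)) =
     T * ((1 - u^2) * (1 - u * q ^ 2) * (- x * (1 - q^2 * x)) * (- x * (1 - q * x)))"
    by (simp only: power2_eq_square)
  then have "x^2 * (T2 * ((1 - q^2) * (1 - u * (q * x)) * (1 - u * (q^2 * x)) * (1 - u))) =
     x^2 * (T * ((1 - u^2) * (1 - u * q ^ 2) * (1 - q^2 * x) * (1 - q * x)))"
    by algebra
  then have T2: "T2 = T * ((1 - u^2) * (1 - u * q ^ 2) * (1 - q^2 * x) * (1 - q * x)) /
      ((1 - q^2) * (1 - u * (q * x)) * (1 - u * (q^2 * x)) * (1 - u))"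
    using nz by (subst nonzero_eq_divide_eq) (simp_all add: mult.assoc)
  have "u - u * q^2 = q * x^2 * (1 - q^2)" "q * x - u * q^2 = q * x * (1 - q^2 * x)"
     "u * q^2 * (q * x) = q^4 * x^3"
    by (simp_all add: ux algebra_simps power2_eq_square power3_eq_cube numeral_eq_Suc)
  then have r: "wz_ratio q (u * q^2) M = (1 - u^2 * q^2) * (q * x^2 * (1 - q^2)) * (1 - u) /
      ((1 - q^4 * x^3) * (q * x * (1 - q^2 * x)) * (1 - q * x))"
    unfolding wz_ratio_def pw by (simp add: power2_eq_square mult_ac)
  have "T2 * wz_ratio q (u * q^2) M * (1 - q^4 * x^3) =
      T * (1 - u * q^2) * (1 - u^2 * q^2) * (1 - u^2) * x / ((1 - u * (q * x)) * (1 - u * (q^2 * x)))"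
    unfolding T2 r using nz q0 by (simp add: power2_eq_square)
  moreover have "wz_term q (u * q^2) (Suc M) = - ((- 1) ^ M / (1 - q) * (T2 * wz_ratio q (u * q^2) M * (1 - q^4 * x^3)))"
    using qint_closed_form[OF qn1, of "3 * Suc M + 1"] unfolding pw
    by (simp add: wz_term_def T2_def)
  ultimately have last: "wz_term q (u * q^2) (Suc M) = - Q"
    by (simp add: Q_def mult_ac)
  have qi: "qint q (2 * M + 1) = (1 - u) / (1 - q)" "qint q (2 * Suc M + 1) = (1 - u * q^2) / (1 - q)"
    using qint_closed_form[OF qn1, of "2 * M + 1"] qint_closed_form[OF qn1, of "2 * Suc M + 1"] unfolding pw by simp_all
  have "(\<Sum>k\<le>Suc M. wz_term q (u * q^2) k) = - (u * (1 - u * q^2) / (1 - u) * (\<Sum>j\<le>M. wz_term q u j))"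
    using tele last by (simp add: algebra_simps)
  also have "\<dots> = (- 1) ^ Suc M * (u * q ^ M\<^sup>2) * ((1 - u * q^2) / (1 - q))"
    unfolding Suc.IH[unfolded pw(4)] qi(1)[unfolded pw(4)] using nz by simp
  also have "u * q ^ M\<^sup>2 = q ^ (Suc M)\<^sup>2"
    unfolding u_def power_add[symmetric] by (rule arg_cong[of _ _ "\<lambda>m. q ^ m"]) (simp add: power2_eq_square)
  finally show ?case unfolding qi pw .
qed

text \<open>By \<open>(1 - u * y) * (y - u) = y * (1 - u) ^ 2 - u * (1 - y) ^ 2\<close> and the same
  formula for \<open>w\<close>, the parts without \<open>(1 - u) ^ 2\<close> cancel. The cofactor is
  a polynomial times inverses of denominator factors, so its regularity can be read off.\<close>

lemma wz_ratio_diff: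
  fixes u y w :: "'a::field"
  assumes "1 - u * w \<noteq> 0" "w - u \<noteq> 0" "1 - w \<noteq> 0"
  shows "((1 - u * y) * (y - u) * (1 - y)) / ((1 - u * w) * (w - u) * (1 - w)) -
      ((1 - y) * (y - 1) * (1 - y)) / ((1 - w) * (w - 1) * (1 - w)) =
    (1 - u) ^ 2 * ((1 - y) * (y * (1 - w) ^ 2 - w * (1 - y) ^ 2) *
      (inverse (1 - w) ^ 3 * inverse (1 - u * w) * inverse (w - u)))"
proof -
  have 1: "((1 - y) * (y - 1) * (1 - y)) / ((1 - w) * (w - 1) * (1 - w)) = (1 - y) ^ 3 / (1 - w) ^ 3"
  proof -
    have "(1 - y) * (y - 1) * (1 - y) = - ((1 - y) ^ 3)" "(1 - w) * (w - 1) * (1 - w) = - ((1 - w) ^ 3)"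
      by algebra+
    then show ?thesis by simp
  qed
  define a b c Y where "a = 1 - u * w" and "b = w - u" and "c = 1 - w" and "Y = 1 - y"
  have nz: "a \<noteq> 0" "b \<noteq> 0" "c \<noteq> 0" using assms by (simp_all add: a_def b_def c_def)
  have 3: "(1 - u * y) * (y - u) * c ^ 2 - Y ^ 2 * (a * b) = (1 - u) ^ 2 * (y * c ^ 2 - w * Y ^ 2)"
    unfolding a_def b_def c_def Y_def by algebra
  have 2: "(K * Y) / (a * b * c) - Y ^ 3 / c ^ 3 =
      (K * c ^ 2 - Y ^ 2 * (a * b)) * Y / (a * b * c ^ 3)" for K
    using nz by (simp add: field_simps power2_eq_square power3_eq_cube)
  show ?thesis
    unfolding 1 unfolding a_def[symmetric] b_def[symmetric] c_def[symmetric] Y_def[symmetric] 2 3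
    by (simp add: divide_inverse power_inverse mult_ac)
qed

section \<open>Congruences of rational functions\<close>

text \<open>The ring of fractions with denominators coprime to \<open>P\<close>; congruence modulo
  \<open>P\<close> is divisibility of the difference by \<open>P\<close> in this ring.\<close>

definition regular_mod :: "rat poly \<Rightarrow> rat poly fract \<Rightarrow> bool" where
  "regular_mod P A \<longleftrightarrow> (\<exists>U V. V \<noteq> 0 \<and> coprime V P \<and> A = to_fract U / to_fract V)"

lemma regular_modI:
  "V \<noteq> 0 \<Longrightarrow> coprime V P \<Longrightarrow> A = to_fract U / to_fract V \<Longrightarrow> regular_mod P A"
  unfolding regular_mod_def by blast

lemma ratfun_congI:
  "regular_mod P R \<Longrightarrow> A - B = to_fract P * R \<Longrightarrow> ratfun_cong A B P"
  unfolding ratfun_cong_def regular_mod_def by blast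

lemma ratfun_cong_iff:
  "ratfun_cong A B P \<longleftrightarrow> (\<exists>R. regular_mod P R \<and> A - B = to_fract P * R)"
  unfolding ratfun_cong_def regular_mod_def by blast

lemma regular_mod_power_iff: "k > 0 \<Longrightarrow> regular_mod (P ^ k) A \<longleftrightarrow> regular_mod P A"
  by (simp add: regular_mod_def)

lemma regular_mod_to_fract [simp]: "regular_mod P (to_fract U)"
  unfolding regular_mod_def by (rule exI[of _ U], rule exI[of _ 1]) simp

lemma regular_mod_0 [simp]: "regular_mod P 0" and regular_mod_1 [simp]: "regular_mod P 1"
  using regular_mod_to_fract[of P 0] regular_mod_to_fract[of P 1] by simp_all

lemma regular_mod_inverse: "V \<noteq> 0 \<Longrightarrow> coprime V P \<Longrightarrow> regular_mod P (inverse (to_fract V))"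
  unfolding regular_mod_def by (rule exI[of _ 1], rule exI[of _ V]) (simp add: inverse_eq_divide)

lemma regular_mod_mult:
  assumes "regular_mod P A" "regular_mod P B"
  shows "regular_mod P (A * B)"
proof -
  obtain U V U' V' where "V \<noteq> 0" "coprime V P" "A = to_fract U / to_fract V"
    "V' \<noteq> 0" "coprime V' P" "B = to_fract U' / to_fract V'"
    using assms unfolding regular_mod_def by blast
  then show ?thesis
    by (intro regular_modI[of "V * V'" _ _ "U * U'"]) simp_all
qed

lemma regular_mod_add:
  assumes "regular_mod P A" "regular_mod P B"
  shows "regular_mod P (A + B)"
proof -
  obtain U V U' V' where "V \<noteq> 0" "coprime V P" "A = to_fract U / to_fract V"
    "V' \<noteq> 0" "coprime V' P" "B = to_fract U' / to_fract V'"
    using assms unfolding regular_mod_def by blast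
  then show ?thesis
    by (intro regular_modI[of "V * V'" _ _ "U * V' + U' * V"]) (simp_all add: add_frac_eq)
qed

lemma regular_mod_uminus: "regular_mod P A \<Longrightarrow> regular_mod P (- A)"
  using regular_mod_mult[OF regular_mod_to_fract[of P "- 1"], of A] by simp

lemma regular_mod_diff: "regular_mod P A \<Longrightarrow> regular_mod P B \<Longrightarrow> regular_mod P (A - B)"
  using regular_mod_add[of P A "- B"] regular_mod_uminus by simp

lemma regular_mod_prod: "(\<And>i. i \<in> I \<Longrightarrow> regular_mod P (f i)) \<Longrightarrow> regular_mod P (\<Prod>i\<in>I. f i)"
  by (induction I rule: infinite_finite_induct) (auto intro: regular_mod_mult)

lemma regular_mod_sum: "(\<And>i. i \<in> I \<Longrightarrow> regular_mod P (f i)) \<Longrightarrow> regular_mod P (\<Sum>i\<in>I. f i)"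
  by (induction I rule: infinite_finite_induct) (auto intro: regular_mod_add)

lemma regular_mod_power: "regular_mod P A \<Longrightarrow> regular_mod P (A ^ k)"
  by (induction k) (auto intro: regular_mod_mult)

lemmas regular_mod_intros = regular_mod_mult regular_mod_add regular_mod_uminus regular_mod_diff
  regular_mod_prod regular_mod_sum regular_mod_power

section \<open>Congruences and ring operations\<close>

lemma ratfun_cong_refl [simp]: "ratfun_cong A A P"
  unfolding ratfun_cong_iff by (rule exI[of _ 0]) simp

lemma ratfun_cong_add:
  assumes "ratfun_cong A B P" "ratfun_cong C D P"
  shows "ratfun_cong (A + C) (B + D) P"
proof -
  obtain R S where R: "regular_mod P R" "A - B = to_fract P * R"
    and S: "regular_mod P S" "C - D = to_fract P * S"
    using assms unfolding ratfun_cong_iff by blast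
  have "A + C - (B + D) = to_fract P * (R + S)"
    unfolding distrib_left R(2)[symmetric] S(2)[symmetric] by simp
  then show ?thesis by (rule ratfun_congI[OF regular_mod_add[OF R(1) S(1)]])
qed

lemma ratfun_cong_trans [trans]:
  assumes "ratfun_cong A B P" "ratfun_cong B C P"
  shows "ratfun_cong A C P"
  using ratfun_cong_add[OF assms] by (simp add: ratfun_cong_iff)

lemma ratfun_cong_sym:
  assumes "ratfun_cong A B P"
  shows "ratfun_cong B A P"
proof -
  obtain R where R: "regular_mod P R" "A - B = to_fract P * R"
    using assms unfolding ratfun_cong_iff by blast
  have "B - A = to_fract P * - R"
    unfolding mult_minus_right R(2)[symmetric] by simp
  then show ?thesis by (rule ratfun_congI[OF regular_mod_uminus[OF R(1)]])
qed

lemma ratfun_cong_sum: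
  "(\<And>i. i \<in> I \<Longrightarrow> ratfun_cong (f i) (g i) P) \<Longrightarrow> ratfun_cong (\<Sum>i\<in>I. f i) (\<Sum>i\<in>I. g i) P"
  by (induction I rule: infinite_finite_induct) (auto intro: ratfun_cong_add)

lemma ratfun_cong_mult_left:
  assumes "ratfun_cong A B P" "regular_mod P C"
  shows "ratfun_cong (C * A) (C * B) P"
proof -
  obtain R where "regular_mod P R" "A - B = to_fract P * R"
    using assms(1) unfolding ratfun_cong_iff by blast
  then show ?thesis
    unfolding ratfun_cong_iff using assms(2)
    by (intro exI[of _ "C * R"]) (auto simp: regular_mod_mult simp flip: right_diff_distrib)
qed

lemma ratfun_cong_mult_right:
  "ratfun_cong A B P \<Longrightarrow> regular_mod P C \<Longrightarrow> ratfun_cong (A * C) (B * C) P"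
  using ratfun_cong_mult_left[of A B P C] by (simp add: mult.commute)

lemma ratfun_cong_mult:
  "ratfun_cong A B P \<Longrightarrow> ratfun_cong C D P \<Longrightarrow> regular_mod P B \<Longrightarrow> regular_mod P C \<Longrightarrow>
   ratfun_cong (A * C) (B * D) P"
  by (blast intro: ratfun_cong_trans ratfun_cong_mult_left ratfun_cong_mult_right)

lemma ratfun_cong_prod:
  assumes "\<And>i. i \<in> I \<Longrightarrow> ratfun_cong (f i) (g i) P"
    "\<And>i. i \<in> I \<Longrightarrow> regular_mod P (f i)" "\<And>i. i \<in> I \<Longrightarrow> regular_mod P (g i)"
  shows "ratfun_cong (\<Prod>i\<in>I. f i) (\<Prod>i\<in>I. g i) P"
  using assms
  by (induction I rule: infinite_finite_induct) (auto intro!: ratfun_cong_mult regular_mod_prod)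

lemma ratfun_cong_diff_iff: "ratfun_cong (A - B) 0 P \<longleftrightarrow> ratfun_cong A B P"
  by (simp add: ratfun_cong_iff)

text \<open>Orders of vanishing add. The exponents are positive because a congruence modulo
  \<open>P ^ 0 = 1\<close> gives no control over denominators.\<close>

lemma ratfun_cong_0_mult:
  assumes "ratfun_cong A 0 (P ^ i)" "ratfun_cong B 0 (P ^ j)" "i > 0" "j > 0"
  shows "ratfun_cong (A * B) 0 (P ^ (i + j))"
proof -
  obtain R S where "regular_mod P R" "A = to_fract (P ^ i) * R" "regular_mod P S" "B = to_fract (P ^ j) * S"
    using assms unfolding ratfun_cong_iff by (auto simp: regular_mod_power_iff)
  moreover have "regular_mod (P ^ (i + j)) (R * S)"
    using calculation assms(3) by (simp add: regular_mod_mult regular_mod_power_iff)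
  ultimately show ?thesis
    by (intro ratfun_congI[of _ "R * S"]) (simp_all add: power_add)
qed

lemma ratfun_cong_0_mult_left:
  "ratfun_cong A 0 P \<Longrightarrow> regular_mod P C \<Longrightarrow> ratfun_cong (C * A) 0 P"
  using ratfun_cong_mult_left[of A 0 P C] by simp

lemma ratfun_cong_0_mult_right:
  "ratfun_cong A 0 P \<Longrightarrow> regular_mod P C \<Longrightarrow> ratfun_cong (A * C) 0 P"
  using ratfun_cong_mult_right[of A 0 P C] by simp

lemma ratfun_cong_0_power: "ratfun_cong A 0 P \<Longrightarrow> ratfun_cong (A ^ Suc k) 0 (P ^ Suc k)"
proof (induction k)
  case (Suc k)
  then show ?case
    using ratfun_cong_0_mult[of A P 1 "A ^ Suc k" "Suc k"] by simp
qed simp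

lemma ratfun_cong_power:
  "ratfun_cong A B P \<Longrightarrow> regular_mod P A \<Longrightarrow> regular_mod P B \<Longrightarrow> ratfun_cong (A ^ k) (B ^ k) P"
  by (induction k) (auto intro: ratfun_cong_mult regular_mod_power)

lemma ratfun_cong_divide:
  assumes "ratfun_cong A B P" "ratfun_cong C D P" "C \<noteq> 0" "D \<noteq> 0"
    and "regular_mod P B" "regular_mod P D" "regular_mod P (inverse C)" "regular_mod P (inverse D)"
  shows "ratfun_cong (A / C) (B / D) P"
proof -
  have "A / C - B / D = ((A - B) * D + (D - C) * B) * (inverse C * inverse D)"
    using assms(3,4) by (simp add: field_simps)
  moreover have "ratfun_cong (((A - B) * D + (D - C) * B) * (inverse C * inverse D)) 0 P"
  proof -
    have "ratfun_cong ((A - B) * D + (D - C) * B) (0 + 0) P"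
      by (intro ratfun_cong_add ratfun_cong_0_mult_right)
        (simp_all add: ratfun_cong_diff_iff assms ratfun_cong_sym)
    then show ?thesis
      by (intro ratfun_cong_0_mult_right regular_mod_mult assms) simp
  qed
  ultimately have "ratfun_cong (A / C - B / D) 0 P" by (simp only:)
  then show ?thesis by (simp only: ratfun_cong_diff_iff)
qed

lemma ratfun_cong_dvd:
  assumes "ratfun_cong A B Q" "P dvd Q"
  shows "ratfun_cong A B P"
proof -
  from assms obtain T where Q: "Q = P * T" by blast
  from assms(1) obtain U V where "V \<noteq> 0" "coprime V Q" "A - B = to_fract Q * (to_fract U / to_fract V)"
    unfolding ratfun_cong_def by blast
  then show ?thesis unfolding Q
    by (intro ratfun_congI[of _ "to_fract (T * U) / to_fract V"] regular_modI[of V _ _ "T * U"]) simp_all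
qed

lemma ratfun_cong_0_to_fract: "P dvd X \<Longrightarrow> ratfun_cong (to_fract X) 0 P"
  by (auto elim!: dvdE intro: ratfun_congI[OF regular_mod_to_fract])

text \<open>The witnesses \<open>U\<close> and \<open>V\<close> may change with the modulus, so the
  difference is first put in lowest terms \<open>N / D\<close>. Each congruence then forces
  \<open>P i\<close> to divide \<open>N\<close> and to be coprime to \<open>D\<close>, and pairwise
  coprimality yields the product.\<close>

lemma ratfun_cong_prod_moduli:
  assumes "finite I" "\<And>i j. i \<in> I \<Longrightarrow> j \<in> I \<Longrightarrow> i \<noteq> j \<Longrightarrow> coprime (P i) (P j)"
    and "\<And>i. i \<in> I \<Longrightarrow> ratfun_cong A B (P i)"
  shows "ratfun_cong A B (\<Prod>i\<in>I. P i)"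
proof -
  obtain N D where ND: "quot_of_fract (A - B) = (N, D)" by fastforce
  have D: "D \<noteq> 0" "coprime N D"
    using snd_quot_of_fract_nonzero[of "A - B"] coprime_quot_of_fract[of "A - B"] unfolding ND by simp_all
  have AB: "A - B = to_fract N / to_fract D"
    using quot_to_fract_quot_of_fract[of "A - B"] unfolding ND by (simp add: quot_to_fract_def Fract_conv_to_fract)
  have *: "P i dvd N \<and> coprime D (P i)" if i: "i \<in> I" for i
  proof -
    obtain U V where V: "V \<noteq> 0" "coprime V (P i)" "A - B = to_fract (P i) * (to_fract U / to_fract V)"
      using assms(3)[OF i] unfolding ratfun_cong_def by blast
    then have "to_fract (N * V) = to_fract (P i * U * D)"
      using D unfolding AB by (simp add: divide_simps mult_ac)
    then have eq: "N * V = P i * U * D" by (simp only: to_fract_eq_iff)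
    have "D dvd V * N" by (metis eq dvd_triv_right mult.commute)
    then have "D dvd V" using coprime_dvd_mult_left_iff[of D N V] D(2) by (simp add: coprime_commute)
    then have "coprime D (P i)" using coprime_divisors[OF _ dvd_refl V(2)] by blast
    moreover have "P i dvd N * V" unfolding eq by (simp add: mult.assoc)
    then have "P i dvd N" using coprime_dvd_mult_left_iff[of "P i" V N] V(2) by (simp add: coprime_commute)
    ultimately show ?thesis by blast
  qed
  have "(\<Prod>i\<in>I. P i) dvd N"
    using assms(1,2) * by (induction I rule: finite_induct) (auto intro!: divides_mult prod_coprime_right)
  then obtain U where U: "N = (\<Prod>i\<in>I. P i) * U" by blast
  have "coprime D (\<Prod>i\<in>I. P i)" using * by (auto intro: prod_coprime_right)
  then show ?thesis unfolding ratfun_cong_def AB using D U by auto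
qed

section \<open>Cyclotomic polynomials\<close>

lemma map_poly_of_rat_monom_add:
  "map_poly (of_rat :: rat \<Rightarrow> complex) (monom a m + [:b:]) = monom (of_rat a) m + [:of_rat b:]"
  by (rule poly_eqI) (simp add: coeff_map_poly of_rat_add coeff_pCons split: nat.splits)

lemma indet_power: "indet ^ m = monom 1 m"
  by (simp add: monom_altdef)

text \<open>A common divisor that is not a unit has a complex root. This reduces coprimality with
  cyclotomic polynomials to the orders of roots of unity.\<close>

lemma coprime_if_no_common_complex_root:
  fixes P Q :: "rat poly"
  assumes "\<And>z :: complex. poly (map_poly of_rat P) z = 0 \<Longrightarrow> poly (map_poly of_rat Q) z \<noteq> 0"
  shows "coprime P Q"
proof (rule ccontr)
  let ?h = "map_poly (of_rat :: rat \<Rightarrow> complex)"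
  assume "\<not> coprime P Q"
  then obtain G where G: "G dvd P" "G dvd Q" "\<not> is_unit G" by (rule not_coprimeE)
  have "\<exists>z. poly (?h G) z = 0"
  proof (cases "G = 0")
    case False
    then have "degree (?h G) \<noteq> 0"
      using G(3) by (simp add: degree_map_poly_of_rat is_unit_iff_degree)
    then show ?thesis
      using fundamental_theorem_of_algebra[of "?h G"] by (simp add: constant_degree)
  qed simp
  then obtain z where "poly (?h G) z = 0" ..
  then have "poly (?h P) z = 0" "poly (?h Q) z = 0"
    using G by (auto elim!: dvdE simp: map_poly_of_rat_mult)
  with assms show False by blast
qed

lemma poly_cyclotomic_eq_0_iff:
  assumes "d > 0"
  shows "poly (map_poly of_rat (cyclotomic d)) z = 0 \<longleftrightarrow> z \<in> primitive_roots_unity d"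
  unfolding map_poly_cyclotomic[OF assms] cyclotomic_complex_def
  using finite_primitive_roots_unity[OF assms] by (simp add: poly_prod)

lemma primitive_root_power_eq_1_iff:
  assumes "z \<in> primitive_roots_unity d" "d > 0"
  shows "z ^ m = 1 \<longleftrightarrow> d dvd m"
proof
  assume "z ^ m = 1"
  moreover have "z ^ m = (z ^ d) ^ (m div d) * z ^ (m mod d)"
    by (simp flip: power_mult power_add)
  ultimately have "z ^ (m mod d) = 1"
    using assms by (simp add: primitive_roots_unity_def)
  then have "m mod d = 0"
    using assms by (fastforce simp: primitive_roots_unity_def)
  then show "d dvd m" by auto
qed (use assms in \<open>auto simp: primitive_roots_unity_def power_mult elim!: dvdE\<close>)

lemma poly_of_rat_1_minus_indet_power:
  "poly (map_poly of_rat (1 - indet ^ m)) (z :: complex) = 1 - z ^ m"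
  using arg_cong[OF map_poly_of_rat_monom_add[of "- 1" m 1], of "\<lambda>p. poly p z"]
  by (simp add: indet_power one_pCons poly_monom minus_monom diff_conv_add_uminus add.commute del: add_uminus_conv_diff)

lemma poly_of_rat_1_plus_indet_power:
  "poly (map_poly of_rat (1 + indet ^ m)) (z :: complex) = 1 + z ^ m"
  using arg_cong[OF map_poly_of_rat_monom_add[of 1 m 1], of "\<lambda>p. poly p z"]
  by (simp add: indet_power one_pCons poly_monom add.commute)

lemma coprime_1_minus_indet_power_cyclotomic:
  assumes "d > 0" "\<not> d dvd m"
  shows "coprime (1 - indet ^ m) (cyclotomic d)"
  using primitive_root_power_eq_1_iff assms
  by (intro coprime_if_no_common_complex_root)
    (auto simp: poly_cyclotomic_eq_0_iff poly_of_rat_1_minus_indet_power)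

text \<open>If \<open>z ^ m = - 1\<close>, then \<open>z ^ d = 1\<close> would give
  \<open>1 = (z ^ m) ^ d = - 1\<close> for odd \<open>d\<close>. This makes the factors of
  \<open>(-q;q)_k\<close> units modulo \<open>cyclotomic d\<close>.\<close>

lemma coprime_1_plus_indet_power_cyclotomic:
  assumes "odd d"
  shows "coprime (1 + indet ^ m) (cyclotomic d)"
proof (rule coprime_if_no_common_complex_root)
  fix z :: complex
  assume "poly (map_poly of_rat (1 + indet ^ m)) z = 0"
  then have zm: "z ^ m = - 1" by (simp add: poly_of_rat_1_plus_indet_power add_eq_0_iff)
  have "z ^ d \<noteq> 1"
  proof
    assume "z ^ d = 1"
    then have "(z ^ m) ^ d = 1" by (metis power_commutes power_mult mult.commute power_one)
    with zm assms show False by simp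
  qed
  then show "poly (map_poly of_rat (cyclotomic d)) z \<noteq> 0"
    using assms by (simp add: poly_cyclotomic_eq_0_iff odd_pos primitive_roots_unity_def)
qed

lemma coprime_indet_power_cyclotomic:
  assumes "d > 0"
  shows "coprime (indet ^ m) (cyclotomic d)"
proof (rule coprime_if_no_common_complex_root)
  fix z :: complex
  assume "poly (map_poly of_rat (indet ^ m)) z = 0"
  then have "z ^ m = 0"
    using map_poly_of_rat_monom_add[of 1 m 0] by (simp add: indet_power poly_monom)
  then have "z ^ d \<noteq> 1" using assms by (auto simp: power_0_left)
  then show "poly (map_poly of_rat (cyclotomic d)) z \<noteq> 0"
    using assms by (simp add: poly_cyclotomic_eq_0_iff primitive_roots_unity_def)
qed

lemma coprime_cyclotomic:
  assumes "d > 0" "e > 0" "d \<noteq> e"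
  shows "coprime (cyclotomic d) (cyclotomic e)"
proof (rule coprime_if_no_common_complex_root)
  fix z :: complex
  assume "poly (map_poly of_rat (cyclotomic d)) z = 0"
  then have "z \<in> primitive_roots_unity d" using assms by (simp add: poly_cyclotomic_eq_0_iff)
  then have "z \<notin> primitive_roots_unity e"
    using assms primitive_root_power_eq_1_iff by (metis dvd_antisym dvd_refl)
  then show "poly (map_poly of_rat (cyclotomic e)) z \<noteq> 0"
    using assms by (simp add: poly_cyclotomic_eq_0_iff)
qed

lemma prod_cyclotomic:
  assumes "n > 0"
  shows "(\<Prod>d | d dvd n. cyclotomic d) = indet ^ n - 1"
proof -
  let ?h = "map_poly (of_rat :: rat \<Rightarrow> complex)"
  have h_prod: "?h (\<Prod>d\<in>A. f d) = (\<Prod>d\<in>A. ?h (f d))" for A and f :: "nat \<Rightarrow> _"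
    by (induction A rule: infinite_finite_induct) (simp_all add: map_poly_of_rat_mult)
  have "?h (\<Prod>d | d dvd n. cyclotomic d) = (\<Prod>d | d dvd n. cyclotomic_complex d)"
    unfolding h_prod by (rule prod.cong) (use assms dvd_pos_nat map_poly_cyclotomic in auto)
  also have "\<dots> = ?h (indet ^ n - 1)"
    unfolding prod_cyclotomic_complex[OF assms] indet_power
    by (rule poly_eqI) (simp add: coeff_map_poly coeff_1)
  finally show ?thesis by (simp only: map_poly_of_rat_eq_iff)
qed

lemma cyclotomic_dvd_1_minus_indet_power:
  assumes "d > 0" "d dvd m"
  shows "cyclotomic d dvd 1 - indet ^ m"
proof (cases "m = 0")
  case False
  have "cyclotomic d dvd (\<Prod>e | e dvd m. cyclotomic e)"
    by (rule dvd_prodI) (use assms False in auto)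
  then show ?thesis
    using False by (simp add: prod_cyclotomic dvd_diff_commute)
qed simp

text \<open>The factor \<open>cyclotomic 1 = indet - 1\<close> is cancelled from the factorization
  of \<open>indet ^ n - 1\<close>. The result splits the modulus into pairwise coprime
  factors.\<close>

lemma qint_eq_prod_cyclotomic:
  assumes "n > 0"
  shows "qint indet n = (\<Prod>d | d dvd n \<and> d > 1. cyclotomic d)"
proof -
  have D: "{d. d dvd n} = insert 1 {d. d dvd n \<and> d > 1}"
    using assms by (auto simp: Suc_lessI dvd_pos_nat)
  have "(\<Prod>d | d dvd n. cyclotomic d) = cyclotomic 1 * (\<Prod>d | d dvd n \<and> d > 1. cyclotomic d)"
    unfolding D by (rule prod.insert) (use assms in auto)
  then have "(indet - 1) * qint indet n = cyclotomic 1 * (\<Prod>d | d dvd n \<and> d > 1. cyclotomic d)"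
    unfolding prod_cyclotomic[OF assms] qint_def power_diff_1_eq .
  moreover have "cyclotomic 1 = indet - 1" by (subst cyclotomic_1) (simp add: one_pCons)
  moreover have "indet - 1 \<noteq> (0 :: rat poly)" by (simp add: one_pCons)
  ultimately show ?thesis by (metis mult_left_cancel)
qed

section \<open>The terms modulo cyclotomic polynomials\<close>

lemma prod_lessThan_add: "(\<Prod>i<a + b. f i) = (\<Prod>i<a. f i) * (\<Prod>i<b. f (a + i :: nat))"
  by (induction b) (simp_all add: mult.assoc)

lemma sum_lessThan_add:
  fixes f :: "nat \<Rightarrow> 'a::comm_monoid_add"
  shows "(\<Sum>i<a + b. f i) = (\<Sum>i<a. f i) + (\<Sum>i<b. f (a + i))"
  by (induction b) (simp_all add: add.assoc)

lemma to_fract_power: "to_fract (x ^ k) = to_fract x ^ k"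
  by (induction k) simp_all

text \<open>Gaussian binomial coefficients, given by the Pascal recursion so that they are
  polynomials in \<open>q\<close> by construction and commute with \<open>to_fract\<close>.\<close>

fun qbinomial :: "'a::comm_ring_1 \<Rightarrow> nat \<Rightarrow> nat \<Rightarrow> 'a" where
  "qbinomial q n 0 = 1"
| "qbinomial q 0 (Suc k) = 0"
| "qbinomial q (Suc n) (Suc k) = qbinomial q n k + q ^ Suc k * qbinomial q n (Suc k)"

lemma qbinomial_eq_0: "n < k \<Longrightarrow> qbinomial q n k = 0"
  by (induction q n k rule: qbinomial.induct) auto

lemma qbinomial_self [simp]: "qbinomial q n n = 1"
  by (induction n) (auto simp: qbinomial_eq_0)

lemma qpoch_Suc: "qpoch x q (Suc m) = qpoch x q m * (1 - x * q ^ m)"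
  by (simp add: qpoch_def)

lemma qpoch_0 [simp]: "qpoch x q 0 = 1"
  by (simp add: qpoch_def)

text \<open>The quotient formula in division-free form. In the Pascal step the weights combine as
  \<open>(1 - q ^ (k + 1)) + q ^ (k + 1) * (1 - q ^ (m + 1)) = 1 - q ^ (m + k + 2)\<close>.\<close>

lemma qbinomial_mult_qpoch:
  "qbinomial q (m + k) k * (qpoch q q k * qpoch q q m) = qpoch q q (m + k)"
proof (induction k arbitrary: m)
  case (Suc k)
  show ?case
  proof (induction m)
    case (Suc m)
    have 1: "qbinomial q (m + Suc k) k * (qpoch q q k * qpoch q q (Suc m)) = qpoch q q (m + Suc k)"
      using Suc.prems \<open>\<And>m. qbinomial q (m + k) k * (qpoch q q k * qpoch q q m) = qpoch q q (m + k)\<close>[of "Suc m"]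
      by simp
    have "qbinomial q (Suc m + Suc k) (Suc k) * (qpoch q q (Suc k) * qpoch q q (Suc m)) =
       qbinomial q (m + Suc k) k * (qpoch q q k * qpoch q q (Suc m)) * (1 - q * q ^ k) +
       q ^ Suc k * (qbinomial q (m + Suc k) (Suc k) * (qpoch q q (Suc k) * qpoch q q m)) * (1 - q * q ^ m)"
      by (simp add: qpoch_Suc algebra_simps)
    also have "\<dots> = qpoch q q (m + Suc k) * (1 - q * q ^ (m + Suc k))"
      unfolding 1 Suc.IH by (simp add: algebra_simps power_add)
    also have "\<dots> = qpoch q q (Suc m + Suc k)" by (simp add: qpoch_Suc)
    finally show ?case .
  qed simp
qed simp

text \<open>The odd exponents give \<open>(q;q^2)_k\<close>, and each even one factors as
  \<open>1 - q ^ (2 * j) = (1 - q ^ j) * (1 + q ^ j)\<close>.\<close>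

lemma qpoch_double: "qpoch q q (2 * k) = qpoch q (q ^ 2) k * (qpoch q q k * (\<Prod>i<k. 1 + q ^ (i + 1)))"
proof (induction k)
  case (Suc k)
  have "1 - q * q ^ (2 * k + 1) = (1 - q * q ^ k) * (1 + q ^ (k + 1))"
    using power_even_eq[of q k] by (simp add: algebra_simps power2_eq_square)
  then have "qpoch q q (2 * Suc k) =
      qpoch q q (2 * k) * (1 - q * (q ^ 2) ^ k) * ((1 - q * q ^ k) * (1 + q ^ (k + 1)))"
    by (simp add: qpoch_Suc power_mult)
  then show ?case
    unfolding Suc.IH qpoch_Suc prod.lessThan_Suc by (simp only: mult_ac)
qed simp

lemma to_fract_qbinomial: "to_fract (qbinomial x n k) = qbinomial (to_fract x) n k"
  by (induction x n k rule: qbinomial.induct) (simp_all add: to_fract_power)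

lemma one_minus_qq_power: "1 - qq ^ m = to_fract (1 - indet ^ m)"
  by (simp add: to_fract_power)

lemma one_minus_indet_power_neq_0: "m > 0 \<Longrightarrow> 1 - indet ^ m \<noteq> 0"
  using degree_monom_eq[of "1 :: rat" m] by (auto simp: indet_power)

lemma qq_power_neq_1: "m > 0 \<Longrightarrow> qq ^ m \<noteq> 1"
  using one_minus_qq_power[of m] one_minus_indet_power_neq_0[of m]
  by (metis diff_self to_fract_eq_0_iff)

lemma qq_power_inject: "qq ^ a = qq ^ b \<longleftrightarrow> a = b"
  by (rule power_eq_iff_of_not_root_of_unity) (use qq_power_neq_1 in auto)

lemma qpoch_qq: "qpoch qq qq k = (\<Prod>i<k. 1 - qq ^ (i + 1))"
  and qpoch_qq_square: "qpoch qq (qq ^ 2) k = (\<Prod>i<k. 1 - qq ^ (2 * i + 1))"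
  by (simp_all add: qpoch_def power_mult)

lemma qpoch_qq_neq_0: "qpoch qq qq k \<noteq> 0"
proof
  assume "qpoch qq qq k = 0"
  then obtain i where "1 - qq ^ (i + 1) = 0"
    unfolding qpoch_qq by (auto simp only: prod_zero_iff finite_lessThan)
  then show False using qq_power_neq_1[of "i + 1"] by (simp only: right_minus_eq) simp
qed

text \<open>The base of the cube in \<open>cq\<close>: if it vanishes modulo
  \<open>cyclotomic d\<close>, then \<open>cq\<close> vanishes modulo the cube.\<close>

definition qratio :: "nat \<Rightarrow> rat poly fract" where
  "qratio k = qpoch qq (qq ^ 2) k / qpoch qq qq k"

lemma cq_eq: "cq k = (- 1) ^ k * qint qq (3 * k + 1) * qratio k ^ 3"
  by (simp add: cq_def qratio_def power_divide)

lemma qratio_eq_prod: "qratio k = (\<Prod>i<k. (1 - qq ^ (2 * i + 1)) / (1 - qq ^ (i + 1)))"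
  by (simp only: qratio_def qpoch_qq qpoch_qq_square prod_dividef)

lemma cq_eq_wz_term: "cq k = wz_term qq 1 k"
proof -
  have "wz_ratio qq 1 i = ((1 - qq ^ (2 * i + 1)) / (1 - qq ^ (i + 1))) ^ 3" for i
  proof -
    have "((1 - y) * (y - 1) * (1 - y)) / ((1 - w) * (w - 1) * (1 - w)) = ((1 - y) / (1 - w)) ^ 3"
      for y w :: "rat poly fract"
    proof -
      have "(1 - y) * (y - 1) * (1 - y) = - ((1 - y) ^ 3)" "(1 - w) * (w - 1) * (1 - w) = - ((1 - w) ^ 3)"
        by algebra+
      then show ?thesis by (simp add: power_divide)
    qed
    then show ?thesis
      unfolding wz_ratio_def mult_1_left .
  qed
  then show ?thesis
    by (simp add: cq_eq wz_term_def qratio_eq_prod prod_power_distrib)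
qed

section \<open>Regularity and vanishing of single terms\<close>

lemma regular_mod_qq_power [simp]: "regular_mod P (qq ^ k)"
  using regular_mod_to_fract[of P "indet ^ k"] by (simp only: to_fract_power)

lemma regular_mod_one_minus_qq_power [simp]: "regular_mod P (1 - qq ^ k)"
  by (rule regular_mod_diff) simp_all

lemma regular_mod_qint [simp]: "regular_mod P (qint qq k)"
  unfolding qint_def by (rule regular_mod_sum) simp

lemma regular_mod_inverse_one_minus_qq_power:
  assumes "d > 0" "\<not> d dvd m"
  shows "regular_mod (cyclotomic d) (inverse (1 - qq ^ m))"
  unfolding one_minus_qq_power
  by (rule regular_mod_inverse[OF one_minus_indet_power_neq_0 coprime_1_minus_indet_power_cyclotomic])
    (use assms in \<open>auto intro: Nat.gr0I\<close>)

lemma one_minus_qq_power_cong_0: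
  "d > 0 \<Longrightarrow> d dvd m \<Longrightarrow> ratfun_cong (1 - qq ^ m) 0 (cyclotomic d)"
  unfolding one_minus_qq_power by (intro ratfun_cong_0_to_fract cyclotomic_dvd_1_minus_indet_power)

text \<open>
  \<open>qratio k\<close> is a \<open>q\<close>-binomial coefficient divided by \<open>(-q;q)\<^sub>k\<close>, and the latter vanishes only at
  roots of unity of even order.
\<close>
lemma regular_mod_qratio:
  assumes "odd d"
  shows "regular_mod (cyclotomic d) (qratio k)"
proof -
  define W where "W = (\<Prod>i<k. 1 + indet ^ (i + 1))"
  have W: "(\<Prod>i<k. 1 + qq ^ (i + 1)) = to_fract W"
  proof -
    have "to_fract (\<Prod>i<k. 1 + x ^ (i + 1)) = (\<Prod>i<k. 1 + to_fract x ^ (i + 1))" for x :: "rat poly"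
      by (induction k) (simp_all add: to_fract_power)
    then show ?thesis by (simp only: W_def)
  qed
  have cop: "coprime W (cyclotomic d)"
    unfolding W_def using assms by (intro prod_coprime_left coprime_1_plus_indet_power_cyclotomic)
  have "poly (1 + indet ^ (i + 1)) 1 = 2" for i by simp
  then have "1 + indet ^ (i + 1) \<noteq> 0" for i by (metis poly_0 zero_neq_numeral)
  then have W0: "W \<noteq> 0" by (simp only: W_def prod_zero_iff finite_lessThan) blast
  \<comment> \<open>Both sides are \<open>qpoch qq qq (2 * k)\<close>; cancelling
    \<open>qpoch qq qq k\<close> exhibits \<open>qratio k\<close> with a denominator coprime to
    \<open>cyclotomic d\<close>.\<close>
  have "qbinomial qq (k + k) k * (qpoch qq qq k * qpoch qq qq k) =
      qpoch qq (qq ^ 2) k * (qpoch qq qq k * to_fract W)"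
    unfolding qbinomial_mult_qpoch W[symmetric] qpoch_double[symmetric] by (simp add: mult_2)
  then have "qratio k = to_fract (qbinomial indet (k + k) k) / to_fract W"
    unfolding qratio_def to_fract_qbinomial using qpoch_qq_neq_0[of k] W0
    by (simp add: frac_eq_eq mult_ac)
  then show ?thesis by (rule regular_modI[OF W0 cop])
qed

lemma regular_mod_cq: "odd d \<Longrightarrow> regular_mod (cyclotomic d) (cq k)"
  unfolding cq_eq by (intro regular_mod_intros regular_mod_qratio) auto

text \<open>The numerator factor with index \<open>h\<close> is \<open>1 - qq ^ d\<close>, while the
  denominators have exponents between \<open>1\<close> and \<open>k < d\<close> and are units modulo
  \<open>cyclotomic d\<close>.\<close>

lemma qratio_cong_0:
  assumes "d = 2 * h + 1" "h < k" "k < d"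
  shows "ratfun_cong (qratio k) 0 (cyclotomic d)"
proof -
  define f where "f i = (1 - qq ^ (2 * i + 1)) * inverse (1 - qq ^ (i + 1))" for i
  have reg: "regular_mod (cyclotomic d) (inverse (1 - qq ^ (i + 1)))" if "i < k" for i
    by (rule regular_mod_inverse_one_minus_qq_power) (use assms that in \<open>auto dest: dvd_imp_le\<close>)
  have "ratfun_cong (f h) 0 (cyclotomic d)"
    unfolding f_def using assms reg
    by (intro ratfun_cong_0_mult_right one_minus_qq_power_cong_0) auto
  moreover have "regular_mod (cyclotomic d) (\<Prod>i\<in>{..<k} - {h}. f i)"
    unfolding f_def using reg by (intro regular_mod_intros regular_mod_one_minus_qq_power) auto
  ultimately have "ratfun_cong (f h * (\<Prod>i\<in>{..<k} - {h}. f i)) 0 (cyclotomic d)"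
    by (rule ratfun_cong_0_mult_right)
  moreover have "qratio k = f h * (\<Prod>i\<in>{..<k} - {h}. f i)"
    unfolding qratio_eq_prod f_def divide_inverse using assms by (intro prod.remove) auto
  ultimately show ?thesis by simp
qed

lemma cq_cong_0:
  assumes "d = 2 * h + 1" "h < k" "k < d"
  shows "ratfun_cong (cq k) 0 (cyclotomic d ^ 3)"
proof -
  have "ratfun_cong (qratio k ^ 3) 0 (cyclotomic d ^ 3)"
    using ratfun_cong_0_power[OF qratio_cong_0[OF assms], of 2] by (simp add: numeral_3_eq_3)
  then show ?thesis
    unfolding cq_eq by (intro ratfun_cong_0_mult_left regular_mod_intros) auto
qed

section \<open>The deformation at \<open>u = q ^ n\<close> and the half sum\<close>

lemma wz_ratio_cong:
  assumes "n = 2 * M + 1" "i < M"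
  shows "ratfun_cong (wz_ratio qq (qq ^ n) i) (wz_ratio qq 1 i) (cyclotomic n ^ 2)"
    and "regular_mod (cyclotomic n) (wz_ratio qq (qq ^ n) i)"
    and "regular_mod (cyclotomic n) (wz_ratio qq 1 i)"
proof -
  let ?P = "cyclotomic n"
  define u y w where "u = qq ^ n" and "y = qq ^ (2 * i + 1)" and "w = qq ^ (i + 1)"
  have n: "n > 0" using assms by simp
  have uw: "1 - u * w = 1 - qq ^ (n + (i + 1))" by (simp add: u_def w_def power_add)
  have "i + 1 + (n - (i + 1)) = n" using assms by simp
  \<comment> \<open>Extracting the unit \<open>w\<close> turns \<open>w - u\<close> into a factor
    \<open>1 - qq ^ m\<close> whose exponent is not divisible by \<open>n\<close>.\<close>
  then have wu: "w - u = w * (1 - qq ^ (n - (i + 1)))"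
    unfolding u_def w_def right_diff_distrib power_add[symmetric] by simp
  have nd: "\<not> n dvd i + 1" "\<not> n dvd n - (i + 1)"
    using assms by (auto dest: dvd_imp_le)
  then have nd': "\<not> n dvd n + (i + 1)" by (simp only: dvd_add_triv_left_iff) simp
  have reg: "regular_mod ?P (inverse (1 - w))" "regular_mod ?P (inverse (1 - u * w))"
    "regular_mod ?P (inverse (w - u))"
  proof -
    show "regular_mod ?P (inverse (1 - w))" unfolding w_def
      by (rule regular_mod_inverse_one_minus_qq_power[OF n]) (fact nd nd')
    show "regular_mod ?P (inverse (1 - u * w))" unfolding uw
      by (rule regular_mod_inverse_one_minus_qq_power[OF n]) (fact nd nd')
    have "regular_mod ?P (inverse w)"
      unfolding w_def to_fract_power[symmetric]
      by (rule regular_mod_inverse[OF _ coprime_indet_power_cyclotomic[OF n]]) simp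
    moreover have "regular_mod ?P (inverse (1 - qq ^ (n - (i + 1))))"
      by (rule regular_mod_inverse_one_minus_qq_power[OF n]) (fact nd nd')
    ultimately show "regular_mod ?P (inverse (w - u))"
      unfolding wu inverse_mult_distrib by (rule regular_mod_mult)
  qed
  have pr: "regular_mod ?P u" "regular_mod ?P y" "regular_mod ?P w"
    unfolding u_def y_def w_def by (rule regular_mod_qq_power)+
  have nz: "1 - u * w \<noteq> 0" "w - u \<noteq> 0" "1 - w \<noteq> 0"
    unfolding uw unfolding u_def w_def
    using qq_power_neq_1[of "n + (i + 1)"] qq_power_neq_1[of "i + 1"] qq_power_inject[of "i + 1" n] assms
    by (simp_all only: right_minus_eq) auto
  define R where "R = (1 - y) * (y * (1 - w) ^ 2 - w * (1 - y) ^ 2) *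
      (inverse (1 - w) ^ 3 * inverse (1 - u * w) * inverse (w - u))"
  have R: "regular_mod ?P R" unfolding R_def
    by (intro regular_mod_intros reg pr regular_mod_1)
  have eq: "wz_ratio qq (qq ^ n) i - wz_ratio qq 1 i = (1 - u) ^ 2 * R"
    using wz_ratio_diff[OF nz, of y] unfolding wz_ratio_def R_def mult_1_left u_def[symmetric] y_def[symmetric] w_def[symmetric] .
  \<comment> \<open>Since \<open>u = qq ^ n\<close> is congruent to \<open>1\<close> modulo
    \<open>cyclotomic n\<close>, the double zero of the difference at \<open>u = 1\<close> becomes
    the modulus \<open>cyclotomic n ^ 2\<close>.\<close>
  have "ratfun_cong ((1 - u) ^ Suc 1) 0 (?P ^ Suc 1)"
    unfolding u_def by (intro ratfun_cong_0_power one_minus_qq_power_cong_0) (use n in auto)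
  then have "ratfun_cong ((1 - u) ^ 2 * R) 0 (?P ^ 2)"
    using R by (intro ratfun_cong_0_mult_right) (simp_all add: numeral_2_eq_2 regular_mod_power_iff del: power_Suc)
  then show "ratfun_cong (wz_ratio qq (qq ^ n) i) (wz_ratio qq 1 i) (?P ^ 2)"
    unfolding eq[symmetric] ratfun_cong_diff_iff .
  have "wz_ratio qq (qq ^ n) i = (1 - u * y) * (y - u) * (1 - y) * (inverse (1 - u * w) * inverse (w - u) * inverse (1 - w))"
    unfolding wz_ratio_def u_def y_def w_def divide_inverse inverse_mult_distrib ..
  also have "regular_mod ?P \<dots>"
    by (intro regular_mod_intros reg pr regular_mod_1)
  finally show a: "regular_mod ?P (wz_ratio qq (qq ^ n) i)" .
  have "wz_ratio qq 1 i = wz_ratio qq (qq ^ n) i - (1 - u) ^ 2 * R"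
    unfolding eq[symmetric] by simp
  also have "regular_mod ?P \<dots>"
    by (intro regular_mod_intros a R pr regular_mod_1)
  finally show "regular_mod ?P (wz_ratio qq 1 i)" .
qed

text \<open>The deformation changes each term only by a multiple of \<open>cyclotomic n ^ 2\<close>,
  and at \<open>u = qq ^ n\<close> the deformed sum is known exactly from
  \<open>wz_sum\<close>.\<close>

lemma sum_cq_cong:
  assumes "n = 2 * M + 1"
  shows "ratfun_cong (\<Sum>k\<le>M. cq k) ((- 1) ^ M * qq ^ M\<^sup>2 * qint qq n) (cyclotomic n ^ 2)"
proof -
  have "ratfun_cong (wz_term qq (qq ^ n) k) (wz_term qq 1 k) (cyclotomic n ^ 2)" if "k \<le> M" for k
    unfolding wz_term_def
    by (intro ratfun_cong_mult_left ratfun_cong_prod regular_mod_intros)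
      (use that in \<open>auto intro!: wz_ratio_cong[OF assms] simp: regular_mod_power_iff\<close>)
  then have "ratfun_cong (\<Sum>k\<le>M. wz_term qq (qq ^ n) k) (\<Sum>k\<le>M. wz_term qq 1 k) (cyclotomic n ^ 2)"
    by (intro ratfun_cong_sum) auto
  moreover have "(\<Sum>k\<le>M. wz_term qq (qq ^ n) k) = (- 1) ^ M * qq ^ M\<^sup>2 * qint qq n"
    unfolding assms by (rule wz_sum) (use qq_power_neq_1 in auto)
  ultimately show ?thesis
    by (simp add: cq_eq_wz_term ratfun_cong_sym)
qed

section \<open>Periodicity and Lucas-type congruences modulo \<open>cyclotomic d\<close>\<close>

lemma one_minus_qq_power_cong:
  assumes "d > 0" "d dvd a"
  shows "ratfun_cong (1 - qq ^ (a + m)) (1 - qq ^ m) (cyclotomic d)"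
proof -
  have "1 - qq ^ (a + m) - (1 - qq ^ m) = qq ^ m * (1 - qq ^ a)"
    by (simp add: power_add algebra_simps)
  moreover have "ratfun_cong (qq ^ m * (1 - qq ^ a)) 0 (cyclotomic d)"
    using assms by (intro ratfun_cong_0_mult_left one_minus_qq_power_cong_0) auto
  ultimately have "ratfun_cong (1 - qq ^ (a + m) - (1 - qq ^ m)) 0 (cyclotomic d)" by (simp only:)
  then show ?thesis by (simp only: ratfun_cong_diff_iff)
qed

lemma qint_qq: "qint qq m = (1 - qq ^ m) * inverse (1 - qq ^ 1)"
  using qint_closed_form[of qq m] qq_power_neq_1[of 1] by (simp add: divide_inverse)

lemma qint_cong:
  assumes "d > 1" "d dvd a"
  shows "ratfun_cong (qint qq (a + m)) (qint qq m) (cyclotomic d)"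
  unfolding qint_qq using assms
  by (intro ratfun_cong_mult_right one_minus_qq_power_cong regular_mod_inverse_one_minus_qq_power) auto

lemma qint_cong_0: "d > 1 \<Longrightarrow> d dvd a \<Longrightarrow> ratfun_cong (qint qq a) 0 (cyclotomic d)"
  using qint_cong[of d a 0] by (simp add: qint_def)

text \<open>Only the last \<open>r\<close> factors are compared one by one: their exponents reduce
  modulo \<open>d\<close>, and their denominators are units because \<open>r < d\<close>. The first
  \<open>l * d\<close> factors may have denominators divisible by \<open>cyclotomic d\<close>, so
  their product is kept whole; it is regular by \<open>regular_mod_qratio\<close>.\<close>

lemma qratio_lucas:
  assumes "odd d" "r < d"
  shows "ratfun_cong (qratio (l * d + r)) (qratio (l * d) * qratio r) (cyclotomic d)"
proof -
  have d: "d > 0" using assms by simp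
  have reg: "regular_mod (cyclotomic d) (inverse (1 - qq ^ (i + 1)))"
    "regular_mod (cyclotomic d) (inverse (1 - qq ^ (l * d + (i + 1))))" if "i < r" for i
  proof -
    have nd: "\<not> d dvd i + 1" using that assms by (auto dest: dvd_imp_le)
    moreover have "d dvd l * d + (i + 1) \<longleftrightarrow> d dvd i + 1" by (rule dvd_add_right_iff) simp
    ultimately show "regular_mod (cyclotomic d) (inverse (1 - qq ^ (i + 1)))"
      "regular_mod (cyclotomic d) (inverse (1 - qq ^ (l * d + (i + 1))))"
      using regular_mod_inverse_one_minus_qq_power[OF d] by blast+
  qed
  have "ratfun_cong (\<Prod>i<r. (1 - qq ^ (2 * l * d + (2 * i + 1))) / (1 - qq ^ (l * d + (i + 1))))
     (\<Prod>i<r. (1 - qq ^ (2 * i + 1)) / (1 - qq ^ (i + 1))) (cyclotomic d)"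
  proof (rule ratfun_cong_prod)
    fix i assume "i \<in> {..<r}"
    then have i: "i < r" by simp
    have "1 - qq ^ (i + 1) \<noteq> 0" "1 - qq ^ (l * d + (i + 1)) \<noteq> 0"
      using qq_power_neq_1[of "i + 1"] qq_power_neq_1[of "l * d + (i + 1)"] by (simp_all only: right_minus_eq) auto
    then show "ratfun_cong ((1 - qq ^ (2 * l * d + (2 * i + 1))) / (1 - qq ^ (l * d + (i + 1))))
      ((1 - qq ^ (2 * i + 1)) / (1 - qq ^ (i + 1))) (cyclotomic d)"
      by (intro ratfun_cong_divide one_minus_qq_power_cong d reg[OF i] regular_mod_one_minus_qq_power) auto
    show "regular_mod (cyclotomic d) ((1 - qq ^ (2 * l * d + (2 * i + 1))) / (1 - qq ^ (l * d + (i + 1))))"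
      "regular_mod (cyclotomic d) ((1 - qq ^ (2 * i + 1)) / (1 - qq ^ (i + 1)))"
      unfolding divide_inverse
      by (intro regular_mod_mult reg[OF i] regular_mod_one_minus_qq_power)+
  qed
  then have "ratfun_cong (qratio (l * d) * (\<Prod>i<r. (1 - qq ^ (2 * l * d + (2 * i + 1))) / (1 - qq ^ (l * d + (i + 1)))))
     (qratio (l * d) * qratio r) (cyclotomic d)"
    unfolding qratio_eq_prod[of r] by (intro ratfun_cong_mult_left regular_mod_qratio assms)
  moreover have "2 * (l * d + i) + 1 = 2 * l * d + (2 * i + 1)" "l * d + i + 1 = l * d + (i + 1)" for i
    by simp_all
  then have "qratio (l * d + r) = qratio (l * d) * (\<Prod>i<r. (1 - qq ^ (2 * l * d + (2 * i + 1))) / (1 - qq ^ (l * d + (i + 1))))"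
    unfolding qratio_eq_prod prod_lessThan_add by (simp only:)
  ultimately show ?thesis by simp
qed

text \<open>The \<open>q\<close>-integer is periodic modulo \<open>cyclotomic d\<close>, and
  \<open>qratio\<close> splits by \<open>qratio_lucas\<close>. The coefficient of
  \<open>cq r\<close> does not depend on \<open>r\<close>, so it can be taken out of the sum over a
  block.\<close>

lemma cq_lucas:
  assumes "odd d" "d > 1" "r < d"
  shows "ratfun_cong (cq (l * d + r)) ((- 1) ^ (l * d) * qratio (l * d) ^ 3 * cq r) (cyclotomic d)"
proof -
  have "3 * (l * d + r) + 1 = 3 * l * d + (3 * r + 1)" by simp
  then have "ratfun_cong (qint qq (3 * (l * d + r) + 1)) (qint qq (3 * r + 1)) (cyclotomic d)"
    using qint_cong[OF assms(2), of "3 * l * d" "3 * r + 1"] by (simp only: dvd_triv_right simp_thms)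
  then have "ratfun_cong (cq (l * d + r))
     ((- 1) ^ (l * d + r) * qint qq (3 * r + 1) * (qratio (l * d) * qratio r) ^ 3) (cyclotomic d)"
    unfolding cq_eq
    by (intro ratfun_cong_mult ratfun_cong_power ratfun_cong_refl qratio_lucas regular_mod_intros
        regular_mod_qratio regular_mod_qint regular_mod_1 assms)
  then show ?thesis
    unfolding cq_eq by (simp add: power_add power_mult_distrib mult_ac)
qed

section \<open>Partial sums of the terms\<close>

lemma sum_cq_beyond_half:
  assumes "d = 2 * h + 1" "h < r" "r \<le> d"
  shows "ratfun_cong (\<Sum>i<r. cq i) (\<Sum>i\<le>h. cq i) (cyclotomic d ^ 3)"
proof -
  have disj: "{..h} \<inter> {h<..<r} = {}" by auto
  have "{..<r} = {..h} \<union> {h<..<r}" using assms by auto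
  then have split: "(\<Sum>i<r. cq i) = (\<Sum>i\<le>h. cq i) + (\<Sum>i\<in>{h<..<r}. cq i)"
    by (metis (no_types) sum.union_disjoint finite_atMost finite_greaterThanLessThan disj)
  have "ratfun_cong (\<Sum>i\<in>{h<..<r}. cq i) (\<Sum>i\<in>{h<..<r}. 0) (cyclotomic d ^ 3)"
    using assms by (intro ratfun_cong_sum cq_cong_0) auto
  then have "ratfun_cong (\<Sum>i\<in>{h<..<r}. cq i) 0 (cyclotomic d ^ 3)" by simp
  from ratfun_cong_add[OF ratfun_cong_refl[of "\<Sum>i\<le>h. cq i"] this] show ?thesis
    unfolding split by simp
qed

text \<open>The sum reduces to the half sum, whose closed form contains \<open>qint qq d\<close>, a
  multiple of \<open>cyclotomic d\<close> as \<open>d > 1\<close>.\<close>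

lemma sum_cq_cong_0:
  assumes "d = 2 * h + 1" "h < r" "r \<le> d" "d > 1"
  shows "ratfun_cong (\<Sum>i<r. cq i) 0 (cyclotomic d)"
proof -
  have "ratfun_cong (\<Sum>i<r. cq i) (\<Sum>i\<le>h. cq i) (cyclotomic d)"
    by (rule ratfun_cong_dvd[OF sum_cq_beyond_half[OF assms(1-3)]]) simp
  also have "ratfun_cong (\<Sum>i\<le>h. cq i) ((- 1) ^ h * qq ^ h\<^sup>2 * qint qq d) (cyclotomic d)"
    by (rule ratfun_cong_dvd[OF sum_cq_cong[OF assms(1)]]) simp
  also have "ratfun_cong ((- 1) ^ h * qq ^ h\<^sup>2 * qint qq d) 0 (cyclotomic d)"
    by (intro ratfun_cong_0_mult_left qint_cong_0 regular_mod_intros) (use assms in auto)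
  finally show ?thesis .
qed

lemma sum_cq_blocks_cong_0:
  assumes "d = 2 * h + 1" "h < r" "r \<le> d" "d > 1"
  shows "ratfun_cong (\<Sum>i<l * d + r. cq i) 0 (cyclotomic d)"
  using assms(2,3)
proof (induction l arbitrary: r)
  case 0
  then show ?case using sum_cq_cong_0 assms by simp
next
  case (Suc l)
  let ?E = "(- 1) ^ (Suc l * d) * qratio (Suc l * d) ^ 3"
  have d: "odd d" using assms by simp
  \<comment> \<open>The \<open>Suc l\<close> complete blocks are the induction hypothesis with
    \<open>r = d\<close>, which is why \<open>r\<close> may equal \<open>d\<close>.\<close>
  have 1: "ratfun_cong (\<Sum>i<l * d + d. cq i) 0 (cyclotomic d)"
    using Suc.IH[of d] assms by simp
  have "ratfun_cong (\<Sum>i<r. cq (Suc l * d + i)) (\<Sum>i<r. ?E * cq i) (cyclotomic d)"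
    by (intro ratfun_cong_sum cq_lucas) (use d assms Suc.prems in auto)
  also have "(\<Sum>i<r. ?E * cq i) = ?E * (\<Sum>i<r. cq i)"
    by (simp only: sum_distrib_left)
  also have "ratfun_cong \<dots> 0 (cyclotomic d)"
    by (intro ratfun_cong_0_mult_left sum_cq_cong_0 regular_mod_intros regular_mod_qratio regular_mod_1)
      (use d assms Suc.prems in auto)
  finally have "ratfun_cong ((\<Sum>i<l * d + d. cq i) + (\<Sum>i<r. cq (Suc l * d + i))) (0 + 0) (cyclotomic d)"
    using 1 by (intro ratfun_cong_add)
  moreover have "Suc l * d = l * d + d" by simp
  ultimately show ?case
    by (simp only: sum_lessThan_add add_0)
qed

section \<open>The double sum\<close>

definition cq_triangle :: "nat \<Rightarrow> rat poly fract" where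
  "cq_triangle n = (\<Sum>j<n. cq j * (\<Sum>i<n - j. cq i))"

text \<open>Both sides run over the pairs with \<open>j + i < n\<close>. In the new order each
  \<open>cq j\<close> meets an initial sum of the terms, to which the vanishing results
  apply.\<close>

lemma cq_triangle_eq: "n > 0 \<Longrightarrow> (\<Sum>k = 0..n - 1. \<Sum>j = 0..k. cq j * cq (k - j)) = cq_triangle n"
proof -
  assume "n > 0"
  then have "{0..n - 1} = {..<n}" by auto
  then have "(\<Sum>k = 0..n - 1. \<Sum>j = 0..k. cq j * cq (k - j)) =
      (\<Sum>k<n. \<Sum>j\<le>k. cq j * cq (k - j))"
    by (simp add: atLeast0AtMost)
  also have "\<dots> = (\<Sum>(j, i)\<in>{(j, i). j + i < n}. cq j * cq i)"
    by (simp add: sum.triangle_reindex)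
  also have "{(j, i). j + i < n} = (SIGMA j:{..<n}. {..<n - j})" by auto
  also have "(\<Sum>(j, i)\<in>(SIGMA j:{..<n}. {..<n - j}). cq j * cq i) = cq_triangle n"
    unfolding cq_triangle_def sum_distrib_left by (simp add: sum.Sigma)
  finally show ?thesis .
qed

text \<open>In every summand one factor vanishes: for \<open>j mod d \<le> h\<close> the partial sum
  of length \<open>n - j\<close> ends past the middle of a block, and otherwise \<open>cq j\<close>
  vanishes by \<open>cq_lucas\<close>.\<close>

lemma cq_triangle_cong_0:
  assumes "odd d" "d > 1" "d dvd n"
  shows "ratfun_cong (cq_triangle n) 0 (cyclotomic d)"
proof -
  obtain h where h: "d = 2 * h + 1" using assms by (auto elim: oddE)
  obtain m where m: "n = m * d" using assms by (auto simp: mult.commute elim: dvdE)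
  have "ratfun_cong (cq j * (\<Sum>i<n - j. cq i)) 0 (cyclotomic d)" if "j < n" for j
  proof (cases "j mod d \<le> h")
    case True
    have "j div d < m" using that m assms by (simp add: less_mult_imp_div_less)
    then obtain l where l: "m = j div d + Suc l" using less_iff_Suc_add by auto
    have "j = j div d * d + j mod d" "j mod d < d" "n = j div d * d + l * d + d"
      using assms by (simp_all add: m l algebra_simps)
    \<comment> \<open>The length within the last block is counted from \<open>1\<close> to
      \<open>d\<close>: for \<open>j mod d = 0\<close> it is \<open>d\<close>, not
      \<open>0\<close>.\<close>
    then have "n - j = l * d + (d - j mod d)" by linarith
    moreover have "h < d - j mod d" using True h by simp
    ultimately have "ratfun_cong (\<Sum>i<n - j. cq i) 0 (cyclotomic d)"
      using sum_cq_blocks_cong_0[OF h, of "d - j mod d" l] assms by simp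
    then show ?thesis by (intro ratfun_cong_0_mult_left regular_mod_cq assms)
  next
    case False
    have "ratfun_cong (cq (j div d * d + j mod d))
       ((- 1) ^ (j div d * d) * qratio (j div d * d) ^ 3 * cq (j mod d)) (cyclotomic d)"
      by (rule cq_lucas) (use assms in auto)
    also have "ratfun_cong (cq (j mod d)) 0 (cyclotomic d)"
      by (rule ratfun_cong_dvd[OF cq_cong_0[OF h]]) (use False assms in auto)
    then have "ratfun_cong ((- 1) ^ (j div d * d) * qratio (j div d * d) ^ 3 * cq (j mod d)) 0 (cyclotomic d)"
      by (intro ratfun_cong_0_mult_left regular_mod_intros regular_mod_qratio regular_mod_1 assms)
    finally have "ratfun_cong (cq j) 0 (cyclotomic d)" by simp
    then show ?thesis by (intro ratfun_cong_0_mult_right regular_mod_intros regular_mod_cq assms)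
  qed
  then show ?thesis
    unfolding cq_triangle_def using ratfun_cong_sum[of "{..<n}" _ "\<lambda>_. 0"] by simp
qed

lemma cq_triangle_cong_cube:
  assumes "n = 2 * M + 1" "M > 0"
  shows "ratfun_cong (cq_triangle n) (qq ^ (M + 1) * qint qq n ^ 2) (cyclotomic n ^ 3)"
proof -
  let ?P = "cyclotomic n"
  have n: "odd n" "n > 1" using assms by auto
  define S T where "S = (\<Sum>k\<le>M. cq k)" and "T = (- 1) ^ M * qq ^ M\<^sup>2 * qint qq n"
  have reg3: "regular_mod (?P ^ 3) A \<longleftrightarrow> regular_mod ?P A" for A
    by (simp add: regular_mod_power_iff)
  have regS: "regular_mod ?P S" unfolding S_def by (intro regular_mod_sum regular_mod_cq n)
  have "ratfun_cong (cq j * (\<Sum>i<n - j. cq i)) (if j \<le> M then cq j * S else 0) (?P ^ 3)" if "j < n" for j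
  proof (cases "j \<le> M")
    case True
    \<comment> \<open>Here \<open>n - j > M\<close> because \<open>j \<le> M\<close>, so the inner
      sum contains the whole half sum.\<close>
    have "ratfun_cong (\<Sum>i<n - j. cq i) S (?P ^ 3)"
      unfolding S_def by (rule sum_cq_beyond_half) (use assms True in auto)
    then show ?thesis
      using True by (auto intro!: ratfun_cong_mult_left simp: reg3 regular_mod_cq n)
  next
    case False
    then have "ratfun_cong (cq j) 0 (?P ^ 3)"
      by (intro cq_cong_0[OF assms(1)] that) auto
    moreover have "regular_mod (?P ^ 3) (\<Sum>i<n - j. cq i)"
      unfolding reg3 by (intro regular_mod_sum regular_mod_cq n)
    ultimately show ?thesis using False by (simp add: ratfun_cong_0_mult_right)
  qed
  then have "ratfun_cong (cq_triangle n) (\<Sum>j<n. if j \<le> M then cq j * S else 0) (?P ^ 3)"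
    unfolding cq_triangle_def by (intro ratfun_cong_sum) auto
  also have "(\<Sum>j<n. if j \<le> M then cq j * S else 0) = (\<Sum>j\<in>{j \<in> {..<n}. j \<le> M}. cq j * S)"
    by (rule sum.inter_filter[symmetric]) simp
  also have "{j \<in> {..<n}. j \<le> M} = {..M}" using assms by auto
  also have "(\<Sum>j\<le>M. cq j * S) = S ^ 2"
    by (simp add: S_def sum_distrib_right power2_eq_square)
  also have "ratfun_cong (S ^ 2) (T ^ 2) (?P ^ 3)"
  proof -
    \<comment> \<open>The factor \<open>S + T\<close>, written \<open>S - T + 2 * T\<close>,
      vanishes to first order because \<open>T\<close> contains \<open>qint qq n\<close>. Multiplied
      by \<open>S - T\<close>, which vanishes to second order, it gives third order.\<close>
    have ST: "ratfun_cong (S - T) 0 (?P ^ 2)"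
      using sum_cq_cong[OF assms(1)] unfolding ratfun_cong_diff_iff S_def T_def .
    then have "ratfun_cong (S - T) 0 ?P" by (rule ratfun_cong_dvd) simp
    moreover have "regular_mod ?P 2"
      using regular_mod_add[OF regular_mod_1 regular_mod_1] by simp
    then have "ratfun_cong (2 * T) 0 ?P"
      unfolding T_def using n
      by (intro ratfun_cong_0_mult_left qint_cong_0 regular_mod_intros regular_mod_qq_power regular_mod_1)
        simp_all
    ultimately have "ratfun_cong (S - T + 2 * T) (0 + 0) (?P ^ 1)"
      unfolding power_one_right by (rule ratfun_cong_add)
    then have "ratfun_cong ((S - T) * (S - T + 2 * T)) 0 (?P ^ (2 + 1))"
      by (intro ratfun_cong_0_mult ST) auto
    moreover have "(S - T) * (S - T + 2 * T) = S ^ 2 - T ^ 2"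
      by (simp add: algebra_simps power2_eq_square)
    ultimately show ?thesis
      unfolding ratfun_cong_diff_iff[of "S ^ 2", symmetric] by (simp add: numeral_3_eq_3)
  qed
  also have "ratfun_cong (T ^ 2) (qq ^ (M + 1) * qint qq n ^ 2) (?P ^ 3)"
  proof -
    \<comment> \<open>With \<open>M' = M - 1\<close> one has
      \<open>2 * M ^ 2 = (M + 1) + n * M'\<close>. Replacing one exponent by the other costs the
      factor \<open>1 - qq ^ (n * M')\<close>, which vanishes to first order; the square of
      \<open>qint qq n\<close> supplies the other two orders.\<close>
    obtain M' where M': "M = Suc M'" using assms by (cases M) auto
    have e: "2 * M\<^sup>2 = M + 1 + n * M'"
      unfolding assms M' by (simp add: power2_eq_square)
    have "T ^ 2 = qq ^ (2 * M\<^sup>2) * qint qq n ^ 2"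
      unfolding T_def power_mult_distrib power_even_eq by (simp flip: power_mult[of "- 1"])
    then have "qq ^ (M + 1) * qint qq n ^ 2 - T ^ 2 = qq ^ (M + 1) * (qint qq n ^ Suc 1 * (1 - qq ^ (n * M')))"
      unfolding e power_add by (simp add: algebra_simps power2_eq_square)
    moreover have "ratfun_cong (qint qq n ^ Suc 1 * (1 - qq ^ (n * M'))) 0 (?P ^ (Suc 1 + 1))"
      using n by (intro ratfun_cong_0_mult ratfun_cong_0_power qint_cong_0) (auto intro: one_minus_qq_power_cong_0)
    ultimately have "ratfun_cong (qq ^ (M + 1) * qint qq n ^ 2 - T ^ 2) 0 (?P ^ 3)"
      using ratfun_cong_0_mult_left[OF _ regular_mod_qq_power] by (simp add: numeral_3_eq_3 del: power_Suc)
    then show ?thesis unfolding ratfun_cong_diff_iff by (rule ratfun_cong_sym)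
  qed
  finally show ?thesis .
qed

section \<open>Combination of the congruences over the divisors of \<open>n\<close>\<close>

theorem theorem1p2:
  fixes n :: nat
  assumes "odd n" and "n > 1"
  shows "ratfun_cong
    (\<Sum>k = 0..n - 1. \<Sum>j = 0..k. cq j * cq (k - j))
    (qq ^ ((n + 1) div 2) * qint qq n ^ 2)
    (qint indet n * cyclotomic n ^ 2)"
proof -
  obtain M where M: "n = 2 * M + 1" using assms by (auto elim: oddE)
  define D where "D = {d. d dvd n \<and> d > 1}"
  \<comment> \<open>The factor \<open>cyclotomic n\<close> of \<open>qint indet n\<close> absorbs
    the extra square, so that the modulus is a product of pairwise coprime factors.\<close>
  define P where "P d = (if d = n then cyclotomic n ^ 3 else cyclotomic d)" for d
  have fin: "finite D" unfolding D_def using assms by simp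
  have nD: "n \<in> D" using assms by (simp add: D_def)
  have "(\<Prod>d\<in>D - {n}. P d) = (\<Prod>d\<in>D - {n}. cyclotomic d)"
    by (rule prod.cong) (auto simp: P_def)
  then have "(\<Prod>d\<in>D. P d) = cyclotomic n ^ 3 * (\<Prod>d\<in>D - {n}. cyclotomic d)"
    using prod.remove[OF fin nD, of P] by (simp add: P_def)
  also have "\<dots> = (\<Prod>d\<in>D. cyclotomic d) * cyclotomic n ^ 2"
    unfolding prod.remove[OF fin nD, of cyclotomic] by (simp add: power3_eq_cube power2_eq_square mult_ac)
  also have "\<dots> = qint indet n * cyclotomic n ^ 2"
    using assms by (simp add: D_def qint_eq_prod_cyclotomic)
  finally have prodP: "(\<Prod>d\<in>D. P d) = qint indet n * cyclotomic n ^ 2" .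
  have "ratfun_cong (cq_triangle n) (qq ^ (M + 1) * qint qq n ^ 2) (\<Prod>d\<in>D. P d)"
  proof (rule ratfun_cong_prod_moduli[OF fin])
    show "coprime (P i) (P j)" if "i \<in> D" "j \<in> D" "i \<noteq> j" for i j
      using that coprime_cyclotomic[of i j] by (auto simp: P_def D_def)
    fix d assume "d \<in> D"
    then have d: "d dvd n" "d > 1" "odd d" using assms by (auto simp: D_def elim: dvd_trans)
    show "ratfun_cong (cq_triangle n) (qq ^ (M + 1) * qint qq n ^ 2) (P d)"
    proof (cases "d = n")
      case True
      then show ?thesis
        using cq_triangle_cong_cube[OF M] assms M by (simp add: P_def)
    next
      case False
      \<comment> \<open>For a proper divisor \<open>d > 1\<close> both sides vanish, the right one
        because \<open>cyclotomic d\<close> divides \<open>qint indet n\<close>.\<close>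
      have "ratfun_cong (qq ^ (M + 1) * (qint qq n * qint qq n)) 0 (cyclotomic d)"
        using d by (intro ratfun_cong_0_mult_left qint_cong_0 regular_mod_qq_power regular_mod_qint)
      then have "ratfun_cong 0 (qq ^ (M + 1) * qint qq n ^ 2) (cyclotomic d)"
        unfolding power2_eq_square by (rule ratfun_cong_sym)
      with cq_triangle_cong_0[OF d(3,2,1)] show ?thesis
        using False unfolding P_def by (simp only: if_False) (rule ratfun_cong_trans)
    qed
  qed
  moreover have "(n + 1) div 2 = M + 1" using M by simp
  ultimately show ?thesis
    using assms cq_triangle_eq[of n] prodP by simp
qed

end
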